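(* Let $T$ be a tree with $n\geq 5$ vertices and let $X_T=\sum_{\lambda\vdash n} c_\lambda\,\mathfrak{st}_\lambda$ be the expansion of its chromatic symmetric function in the star basis. Consider the sum of star coefficients $$nh(T)=c_{221^{n-4}}+c_{321^{n-5}}+\cdots+c_{(n-3)21}+c_{(n-2)2}=\sum_{a=2}^{n-2}c_{a21^{n-a-2}}.$$ Then $$nh(T)=\begin{cases}0,&\text{if }T\not\cong\mathrm{Cat}_{(n-2)2}\text{ and }T\not\cong P_n,\\ 1,&\text{if }T\cong\mathrm{Cat}_{(n-2)2},\\ (-1)^{n-1},&\text{if }T\cong P_n.\end{cases}$$
   Context: For a finite simple graph $G=(V,E)$, a proper colouring is a function $\kappa:V\to\{1,2,3,\ldots\}$ with $\kappa(u)\neq\kappa(v)$ whenever $\{u,v\}\in E$. The chromatic symmetric function of $G$ is $X_G=\sum_{\kappa\text{ proper}}\prod_{v\in V}x_{\kappa(v)}$, a symmetric function in commuting variables $x_1,x_2,\ldots$, homogeneous of degree $|V|$. The star $\mathrm{St}_k$ is the $k$-vertex tree in which $k-1$ leaves are joined to a single central vertex ($\mathrm{St}_1$ is a single vertex). For a partition $\lambda=(\lambda_1,\ldots,\lambda_\ell)$ of $n$, $\mathrm{St}_\lambda$ is the disjoint union of $\mathrm{St}_{\lambda_1},\ldots,\mathrm{St}_{\lambda_\ell}$, and $\mathfrak{st}_\lambda=X_{\mathrm{St}_\lambda}$. It is known that $\{\mathfrak{st}_\lambda:\lambda\vdash n\}$ is a basis (over $\mathbb{Q}$) of the space of symmetric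 functions of degree $n$, called the star basis. The notation $a21^{k}$ denotes the partition with parts $a$, $2$, and $k$ parts equal to $1$. $P_n$ is the path with $n$ vertices. $\mathrm{Cat}_{(n-2)2}$ is the $n$-vertex tree formed from an edge $v_1v_2$ by attaching $n-3$ leaves to $v_1$ and one leaf to $v_2$. *)

theory Defs
  imports Complex_Main "HOL-Library.Multiset" "HOL-Library.FuncSet"
begin

section \<open>Simple graphs and trees\<close>

record 'a graph =
  verts :: "'a set"
  edges :: "'a set set"

definition simple_graph :: "'a graph \<Rightarrow> bool" where
  "simple_graph G \<longleftrightarrow> finite (verts G) \<and> (\<forall>e \<in> edges G. e \<subseteq> verts G \<and> card e = 2)"

definition adjacent :: "'a graph \<Rightarrow> 'a \<Rightarrow> 'a \<Rightarrow> bool" where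
  "adjacent G u v \<longleftrightarrow> {u, v} \<in> edges G"

definition connected_graph :: "'a graph \<Rightarrow> bool" where
  "connected_graph G \<longleftrightarrow> verts G \<noteq> {} \<and>
     (\<forall>u \<in> verts G. \<forall>v \<in> verts G. (adjacent G)\<^sup>*\<^sup>* u v)"

text \<open>A cycle lists each of its vertices once, so the closing edge is a separate condition.\<close>

definition is_cycle :: "'a graph \<Rightarrow> 'a list \<Rightarrow> bool" where
  "is_cycle G vs \<longleftrightarrow> length vs \<ge> 3 \<and> distinct vs \<and>
     successively (adjacent G) vs \<and> adjacent G (last vs) (hd vs)"

definition is_tree :: "'a graph \<Rightarrow> bool" where
  "is_tree G \<longleftrightarrow> simple_graph G \<and> connected_graph G \<and> (\<nexists>vs. is_cycle G vs)"

definition graph_iso :: "'a graph \<Rightarrow> 'b graph \<Rightarrow> bool" (infix "\<cong>\<^sub>g" 50) where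
  "G \<cong>\<^sub>g H \<longleftrightarrow> (\<exists>f. bij_betw f (verts G) (verts H) \<and>
     (\<forall>u \<in> verts G. \<forall>v \<in> verts G. adjacent G u v \<longleftrightarrow> adjacent H (f u) (f v)))"

definition disjoint_union :: "'a graph list \<Rightarrow> (nat \<times> 'a) graph" where
  "disjoint_union Gs =
     \<lparr> verts = {(i, v). i < length Gs \<and> v \<in> verts (Gs ! i)},
       edges = {Pair i ` e | i e. i < length Gs \<and> e \<in> edges (Gs ! i)} \<rparr>"

definition path_graph :: "nat \<Rightarrow> nat graph" where
  "path_graph n = \<lparr> verts = {..<n}, edges = {{i, Suc i} | i. Suc i < n} \<rparr>"

definition star_graph :: "nat \<Rightarrow> nat graph" where
  "star_graph k = \<lparr> verts = {..<k}, edges = {{0, i} | i. 1 \<le> i \<and> i < k} \<rparr>"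

text \<open>
  The tree \<open>Cat\<^bsub>(n-2)2\<^esub>\<close>, for \<open>n \<ge> 4\<close>: \<open>v\<^sub>1\<close> is \<open>0\<close>, \<open>v\<^sub>2\<close> is \<open>1\<close>, the \<open>n - 3\<close> leaves at \<open>v\<^sub>1\<close>
  are \<open>2, \<dots>, n - 2\<close>, and the leaf at \<open>v\<^sub>2\<close> is \<open>n - 1\<close>.
\<close>

definition cat_graph :: "nat \<Rightarrow> nat graph" where
  "cat_graph n =
     \<lparr> verts = {..<n},
       edges = {{0, 1}} \<union> {{0, i} | i. 2 \<le> i \<and> i \<le> n - 2} \<union> {{1, n - 1}} \<rparr>"


section \<open>Chromatic symmetric functions\<close>

text \<open>
  A formal power series of bounded degree in the commuting variables \<open>x\<^sub>1, x\<^sub>2, \<dots>\<close> is represented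
  by its coefficients. The monomial \<open>x\<^bsub>i\<^sub>1\<^esub> \<cdots> x\<^bsub>i\<^sub>d\<^esub>\<close> is the multiset \<open>{#i\<^sub>1, \<dots>, i\<^sub>d#}\<close>.
\<close>

type_synonym series = "nat multiset \<Rightarrow> rat"

text \<open>Restricting to extensional functions makes colourings the functions defined on the vertices.\<close>

definition proper_colourings :: "'a graph \<Rightarrow> ('a \<Rightarrow> nat) set" where
  "proper_colourings G =
     {\<kappa> \<in> verts G \<rightarrow>\<^sub>E {1..}. \<forall>u \<in> verts G. \<forall>v \<in> verts G. adjacent G u v \<longrightarrow> \<kappa> u \<noteq> \<kappa> v}"

definition colouring_monomial :: "'a graph \<Rightarrow> ('a \<Rightarrow> nat) \<Rightarrow> nat multiset" where
  "colouring_monomial G \<kappa> = image_mset \<kappa> (mset_set (verts G))"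

text \<open>
  In the sum of the monomials of all proper colourings, the coefficient of \<open>m\<close> is the number of
  proper colourings with monomial \<open>m\<close>. This number is finite, as the lemma below shows.
\<close>

definition chromatic_sf :: "'a graph \<Rightarrow> series" where
  "chromatic_sf G = (\<lambda>m. of_nat (card {\<kappa> \<in> proper_colourings G. colouring_monomial G \<kappa> = m}))"

lemma finite_colourings_with_monomial:
  assumes "finite (verts G)"
  shows "finite {\<kappa> \<in> proper_colourings G. colouring_monomial G \<kappa> = m}"
proof (rule finite_subset)
  show "{\<kappa> \<in> proper_colourings G. colouring_monomial G \<kappa> = m} \<subseteq> verts G \<rightarrow>\<^sub>E set_mset m"
    using assms by (auto simp: proper_colourings_def colouring_monomial_def PiE_iff extensional_def)
  show "finite (verts G \<rightarrow>\<^sub>E set_mset m)"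
    using assms by (simp add: finite_PiE)
qed


section \<open>The star basis\<close>

definition partitions :: "nat \<Rightarrow> nat list set" where
  "partitions n = {xs. sorted_wrt (\<ge>) xs \<and> 0 \<notin> set xs \<and> sum_list xs = n}"

lemma finite_partitions: "finite (partitions n)"
proof (rule finite_subset)
  have "length xs \<le> sum_list xs" if "0 \<notin> set xs" for xs :: "nat list"
    using that by (induction xs) auto
  then show "partitions n \<subseteq> {xs. set xs \<subseteq> {..n} \<and> length xs \<le> n}"
    by (auto simp: partitions_def dest: member_le_sum_list)
  show "finite {xs. set xs \<subseteq> {..n} \<and> length xs \<le> n}"
    by (rule finite_lists_length_le) simp
qed

definition star_forest :: "nat list \<Rightarrow> (nat \<times> nat) graph" where
  "star_forest \<mu> = disjoint_union (map star_graph \<mu>)"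

definition star_sf :: "nat list \<Rightarrow> series" where
  "star_sf \<mu> = chromatic_sf (star_forest \<mu>)"

definition star_expansion :: "nat \<Rightarrow> series \<Rightarrow> (nat list \<Rightarrow> rat) \<Rightarrow> bool" where
  "star_expansion n X c \<longleftrightarrow> X = (\<lambda>m. \<Sum>\<mu> \<in> partitions n. c \<mu> * star_sf \<mu> m)"

definition nh :: "nat \<Rightarrow> (nat list \<Rightarrow> rat) \<Rightarrow> rat" where
  "nh n c = (\<Sum>a = 2..n - 2. c ([a, 2] @ replicate (n - a - 2) 1))"

end

theory Submission
  imports Defs
begin

text \<open>
  Write \<open>p\<^sub>k = \<Sum>\<^sub>i x\<^sub>i\<^sup>k\<close>. Inclusion and exclusion over the edges that a colouring violates gives
  \<open>X\<^sub>G = \<Sum>\<^bsub>S \<subseteq> E\<^esub> (-1)\<^bsup>|S|\<^esup> p(S)\<close>, where \<open>p(S)\<close> is the product of the \<open>p\<^bsub>|B|\<^esub>\<close> over the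
  connected components \<open>B\<close> of \<open>(V, S)\<close>, here called the blocks of \<open>S\<close>. Products of power sums are
  linearly independent, so a linear functional on them may be given arbitrary values
  (\<open>power_sum_dual\<close>). The proof applies to both sides of the star expansion the functional that
  takes the value \<open>1\<close> on \<open>st\<^bsub>a21\<dots>1\<^esub>\<close> for \<open>a \<ge> 2\<close> and the value \<open>0\<close> on the other members of the star basis.
  It maps the star side to \<open>nh\<close>, so what remains is to compute its value on a tree.

  To find its values on power sums, put \<open>st\<^sub>1 = 1\<close>, \<open>st\<^sub>2 = x\<close> and \<open>st\<^sub>a = y\<close> for \<open>a \<ge> 3\<close>. Binomial
  inversion of \<open>st\<^bsub>k+1\<^esub> = \<Sum>\<^sub>j (-1)\<^sup>j (k choose j) p\<^bsub>j+1\<^esub> p\<^sub>1\<^bsup>k-j\<^esup>\<close> turns \<open>p\<^bsub>k+1\<^esub>\<close> into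
  \<open>1 - k x + (k - 1) y\<close> for \<open>k \<ge> 1\<close> and into \<open>1\<close> for \<open>k = 0\<close>, and the functional adds the
  coefficients of \<open>x\<^sup>2\<close> and \<open>x y\<close>. On a product of power sums this is the sum of \<open>k + k' - k k'\<close> over
  the pairs of factors \<open>p\<^bsub>k+1\<^esub>\<close>, \<open>p\<^bsub>k'+1\<^esub>\<close> with \<open>k, k' \<ge> 1\<close>. For the blocks of an edge subset \<open>S\<close> of
  a forest with \<open>n\<close> vertices, the numbers \<open>k\<close> add up to \<open>s = |S|\<close>, and there are \<open>n - s\<close> blocks. If \<open>i\<close>
  of them are singletons, the sum becomes

    \<open>(n - 1) s - 3/2 s\<^sup>2 - i s + 1/2 (\<Sum>\<^sub>B |B|\<^sup>2 - n - s)\<close>,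

  which is \<open>nh_weight\<close>. In the alternating sum over \<open>S\<close> almost everything cancels. The terms in \<open>s\<close>,
  \<open>s\<^sup>2\<close> and the constant survive only if the forest has at most two edges. Splitting \<open>i s\<close> by the
  isolated vertex, a vertex \<open>v\<close> contributes exactly when one edge misses \<open>v\<close>. Since \<open>\<Sum>\<^sub>B |B|\<^sup>2\<close> counts
  the pairs of vertices linked by \<open>S\<close>, a pair contributes exactly when the path between its members
  uses all edges (\<open>forest_nh_eq\<close>).

  For star forests this formula confirms that the functional has the prescribed values on the star
  basis (\<open>forest_nh_star_forest\<close>). A tree with \<open>n \<ge> 5\<close> vertices has \<open>n - 1 \<ge> 4\<close> edges, and in it

    \<open>nh = #{v. exactly one edge misses v} + 1/2 (-1)\<^bsup>n-1\<^esup> #{(u, v). the path from u to v uses all edges}\<close>.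

  The second number is \<open>2\<close> for a path and \<open>0\<close> otherwise. The first is \<open>1\<close> for \<open>Cat\<^bsub>(n-2)2\<^esub>\<close>, whose vertex
  \<open>v\<^sub>1\<close> is missed by the edge from \<open>v\<^sub>2\<close> to its leaf only, and \<open>0\<close> otherwise.
\<close>


section \<open>Alternating sums over subsets\<close>

text \<open>
  Subsets that differ only in a fixed element \<open>e\<close> have opposite signs; every cancellation below comes
  from pairing them.
\<close>

lemma alternating_sum_insert:
  fixes g :: "'b set \<Rightarrow> rat"
  assumes "finite B" "e \<notin> B"
  shows "(\<Sum>S\<in>Pow (insert e B). (-1) ^ card S * g S)
       = (\<Sum>S\<in>Pow B. (-1) ^ card S * (g S - g (insert e S)))"
proof -
  have card: "card (insert e S) = Suc (card S)" if "S \<in> Pow B" for S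
    using that assms by (meson PowD card_insert_disjoint finite_subset subsetD)
  have inj: "inj_on (insert e) (Pow B)"
    using assms by (auto simp: inj_on_def)
  have "(\<Sum>S\<in>Pow (insert e B). (-1) ^ card S * g S)
      = (\<Sum>S\<in>Pow B. (-1) ^ card S * g S) + (\<Sum>S\<in>insert e ` Pow B. (-1) ^ card S * g S)"
    unfolding Pow_insert using assms by (intro sum.union_disjoint) auto
  also have "(\<Sum>S\<in>insert e ` Pow B. (-1) ^ card S * g S)
      = (\<Sum>S\<in>Pow B. - ((-1) ^ card S * g (insert e S)))"
    using inj by (simp add: sum.reindex card)
  finally show ?thesis
    by (simp add: sum_negf right_diff_distrib sum_subtractf)
qed

lemma alternating_sum_one:
  assumes "finite B"
  shows "(\<Sum>S\<in>Pow B. (-1) ^ card S) = (if B = {} then 1 else 0 :: rat)"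
proof (cases "B = {}")
  case False
  then obtain e where "e \<in> B" by blast
  then have B: "B = insert e (B - {e})" by blast
  show ?thesis
    using alternating_sum_insert[of "B - {e}" e "\<lambda>_. 1"] assms False B by simp
qed simp

lemma alternating_sum_card:
  assumes "finite B"
  shows "(\<Sum>S\<in>Pow B. (-1) ^ card S * of_nat (card S)) = (if card B = 1 then -1 else 0 :: rat)"
proof (cases "B = {}")
  case False
  then obtain e where "e \<in> B" by blast
  then have B: "B = insert e (B - {e})" by blast
  let ?B = "B - {e}"
  have card: "card (insert e S) = Suc (card S)" if "S \<in> Pow ?B" for S
    using that assms by (meson DiffD2 PowD card_insert_disjoint finite_Diff finite_subset insertCI subsetD)
  have "(\<Sum>S\<in>Pow B. (-1) ^ card S * of_nat (card S)) = (\<Sum>S\<in>Pow ?B. - ((-1) ^ card S) :: rat)"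
    using alternating_sum_insert[of ?B e "\<lambda>S. of_nat (card S)"] assms B card
    by (simp cong: sum.cong_simp)
  also have "\<dots> = (if ?B = {} then -1 else 0)"
    using alternating_sum_one[of ?B] assms by (simp add: sum_negf)
  also have "?B = {} \<longleftrightarrow> card B = 1"
    using assms \<open>e \<in> B\<close> by (auto simp: card_1_singleton_iff)
  finally show ?thesis .
qed simp

lemma alternating_sum_card_square:
  assumes "finite B"
  shows "(\<Sum>S\<in>Pow B. (-1) ^ card S * of_nat (card S) ^ 2)
       = (if card B = 2 then 2 else if card B = 1 then -1 else 0 :: rat)"
proof (cases "B = {}")
  case False
  then obtain e where "e \<in> B" by blast
  then have B: "B = insert e (B - {e})" by blast
  let ?B = "B - {e}"
  have card: "card (insert e S) = Suc (card S)" if "S \<in> Pow ?B" for S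
    using that assms by (meson DiffD2 PowD card_insert_disjoint finite_Diff finite_subset insertCI subsetD)
  have "(\<Sum>S\<in>Pow B. (-1) ^ card S * of_nat (card S) ^ 2)
      = (\<Sum>S\<in>Pow ?B. (-1) ^ card S * ((of_nat (card S))\<^sup>2 - (of_nat (card (insert e S)))\<^sup>2) :: rat)"
    using alternating_sum_insert[of ?B e "\<lambda>S. of_nat (card S) ^ 2"] assms B by simp
  also have "\<dots> = (\<Sum>S\<in>Pow ?B. -2 * ((-1) ^ card S * of_nat (card S)) - (-1) ^ card S)"
    by (intro sum.cong) (auto simp: card power2_eq_square algebra_simps)
  also have "\<dots> = -2 * (\<Sum>S\<in>Pow ?B. (-1) ^ card S * of_nat (card S)) - (\<Sum>S\<in>Pow ?B. (-1) ^ card S)"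
    by (simp only: sum_subtractf sum_distrib_left)
  also have "\<dots> = (if card ?B = 1 then 2 else 0) - (if ?B = {} then 1 else 0)"
    using assms by (simp add: alternating_sum_card alternating_sum_one)
  also have "?B = {} \<longleftrightarrow> card B = 1"
    using assms \<open>e \<in> B\<close> by (auto simp: card_1_singleton_iff)
  also have "card ?B = 1 \<longleftrightarrow> card B = 2"
    using assms \<open>e \<in> B\<close> by auto
  finally show ?thesis by simp
qed simp

section \<open>Products of power sums\<close>

text \<open>
  The product \<open>p\<^bsub>xs!0\<^esub> p\<^bsub>xs!1\<^esub> \<cdots>\<close> is expanded by choosing a variable \<open>f i\<close> from each factor
  \<open>p\<^bsub>xs!i\<^esub>\<close>. This choice contributes the monomial \<open>block_monomial xs f\<close>.
\<close>

definition block_monomial :: "nat list \<Rightarrow> (nat \<Rightarrow> nat) \<Rightarrow> nat multiset" where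
  "block_monomial xs f = (\<Sum>i<length xs. replicate_mset (xs ! i) (f i))"

definition power_sum :: "nat list \<Rightarrow> series" where
  "power_sum xs m = of_nat (card {f \<in> {..<length xs} \<rightarrow>\<^sub>E {1..}. block_monomial xs f = m})"

lemma count_block_monomial:
  "count (block_monomial xs f) c = (\<Sum>i | i < length xs \<and> f i = c. xs ! i)"
proof -
  have "count (block_monomial xs f) c = (\<Sum>i<length xs. if f i = c then xs ! i else 0)"
    by (simp add: block_monomial_def count_sum) (metis (no_types))
  also have "\<dots> = (\<Sum>i\<in>{i. i < length xs \<and> f i = c}. xs ! i)"
    by (subst sum.inter_filter[symmetric]) (auto intro: sum.cong)
  finally show ?thesis .
qed

lemma mem_block_monomial:
  assumes "0 \<notin> set xs"
  shows "set_mset (block_monomial xs f) = f ` {..<length xs}"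
proof -
  have "xs ! i \<noteq> 0" if "i < length xs" for i
    using that assms by (metis nth_mem)
  then show ?thesis
    by (simp add: block_monomial_def set_mset_sum set_mset_replicate_mset_subset)
      (auto split: if_splits)
qed

lemma power_sum_Suc_nonzero:
  assumes "0 \<notin> set xs"
  shows "power_sum xs (block_monomial xs Suc) \<noteq> 0"
proof -
  let ?A = "{f \<in> {..<length xs} \<rightarrow>\<^sub>E {1..}. block_monomial xs f = block_monomial xs Suc}"
  have "f ` {..<length xs} = Suc ` {..<length xs}" if "f \<in> ?A" for f
    using that mem_block_monomial[OF assms, of f] mem_block_monomial[OF assms, of Suc] by simp
  then have "?A \<subseteq> {..<length xs} \<rightarrow>\<^sub>E Suc ` {..<length xs}"
    by (simp add: subset_iff PiE_iff) (metis (mono_tags, lifting) imageI lessThan_iff)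
  then have "finite ?A"
    by (rule finite_subset) (simp add: finite_PiE)
  moreover have "restrict Suc {..<length xs} \<in> ?A"
    by (auto simp: block_monomial_def)
  ultimately show ?thesis
    unfolding power_sum_def of_nat_eq_0_iff by (simp only: card_0_eq) blast
qed

lemma image_mset_nth_upto: "image_mset ((!) xs) (mset_set {..<length xs}) = mset xs"
  using mset_map[of "(!) xs" "[0..<length xs]"]
  by (simp add: map_nth mset_set_upto_eq_mset_upto del: mset_map)

text \<open>
  The monomial \<open>block_monomial xs Suc\<close> has the exponents \<open>xs\<close> on distinct variables. To obtain it from
  the factors \<open>ys\<close>, these must be distributed over \<open>length xs\<close> variables, none of which stays empty.
  So at least \<open>length xs\<close> factors are needed, and if there are no more, each exponent is a single factor.
\<close>

lemma power_sum_triangular: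
  assumes "power_sum ys (block_monomial xs Suc) \<noteq> 0" "0 \<notin> set xs" "0 \<notin> set ys"
    and "length ys \<le> length xs"
  shows "mset ys = mset xs"
proof -
  obtain f where f: "f \<in> {..<length ys} \<rightarrow>\<^sub>E {1..}" and eq: "block_monomial ys f = block_monomial xs Suc"
    using assms(1) unfolding power_sum_def by (metis (mono_tags, lifting) Collect_empty_eq card.empty of_nat_0)
  have img: "f ` {..<length ys} = Suc ` {..<length xs}"
    using mem_block_monomial[OF assms(3), of f] mem_block_monomial[OF assms(2), of Suc] eq by simp
  have "card (f ` {..<length ys}) = length xs"
    by (simp add: img card_image)
  moreover have "card (f ` {..<length ys}) \<le> length ys"
    using card_image_le[of "{..<length ys}" f] by simp
  ultimately have len: "length ys = length xs" and card: "card (f ` {..<length ys}) = length ys"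
    using assms(4) by linarith+
  have inj: "inj_on f {..<length ys}"
    using card by (intro eq_card_imp_inj_on) simp_all
  have nth: "ys ! j = xs ! (f j - 1)" if "j < length ys" for j
  proof -
    have "f j \<in> f ` {..<length ys}" using that by simp
    then have "f j \<in> Suc ` {..<length xs}" unfolding img .
    then obtain i where i: "i < length xs" "f j = Suc i" by auto
    have "k = j" if "k < length ys" "f k = Suc i" for k
      by (rule inj_onD[OF inj]) (use that i \<open>j < length ys\<close> in auto)
    then have "{k. k < length ys \<and> f k = Suc i} = {j}"
      using that i(2) by blast
    then have "count (block_monomial ys f) (Suc i) = ys ! j"
      by (simp add: count_block_monomial)
    moreover have "{k. k < length xs \<and> k = i} = {i}"
      using i by auto
    then have "count (block_monomial xs Suc) (Suc i) = xs ! i"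
      by (simp add: count_block_monomial)
    ultimately show ?thesis using eq i by simp
  qed
  have bij: "bij_betw (\<lambda>j. f j - 1) {..<length ys} {..<length xs}"
    unfolding bij_betw_def
  proof
    show "inj_on (\<lambda>j. f j - 1) {..<length ys}"
    proof (rule inj_onI)
      fix i j assume ij: "i \<in> {..<length ys}" "j \<in> {..<length ys}" "f i - 1 = f j - 1"
      then have "f i \<ge> 1" "f j \<ge> 1" using f by (auto simp: PiE_iff)
      then have "f i = f j" using ij(3) by simp
      then show "i = j" using inj ij by (auto simp: inj_on_def)
    qed
    have "(\<lambda>j. f j - 1) ` {..<length ys} = (\<lambda>k. k - 1) ` (f ` {..<length ys})"
      by (simp add: image_image)
    then show "(\<lambda>j. f j - 1) ` {..<length ys} = {..<length xs}"
      by (simp add: img image_image)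
  qed
  have "mset ys = image_mset (\<lambda>j. xs ! (f j - 1)) (mset_set {..<length ys})"
    unfolding image_mset_nth_upto[of ys, symmetric] using nth by (intro image_mset_cong) simp
  also have "\<dots> = image_mset ((!) xs) (image_mset (\<lambda>j. f j - 1) (mset_set {..<length ys}))"
    by (simp add: multiset.map_comp comp_def)
  also have "image_mset (\<lambda>j. f j - 1) (mset_set {..<length ys}) = mset_set {..<length xs}"
    using bij by (simp add: bij_betw_def image_mset_mset_set)
  also have "image_mset ((!) xs) (mset_set {..<length xs}) = mset xs"
    by (rule image_mset_nth_upto)
  finally show ?thesis .
qed

lemma partition_eq_if_mset_eq:
  assumes "xs \<in> partitions n" "ys \<in> partitions n" "mset xs = mset ys"
  shows "xs = ys"
proof -
  have "sorted (rev xs)" "sorted (rev ys)"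
    unfolding sorted_wrt_rev using assms(1,2) unfolding partitions_def by blast+
  then have "sort xs = rev xs" "sort xs = rev ys"
    using assms(3) by (simp_all add: properties_for_sort)
  then show ?thesis by simp
qed

text \<open>
  The linear independence of the products of power sums, in the form in which it is used: arbitrary
  values \<open>h\<close> on these products are realised by a finite linear combination of coefficient extractions.
  A partition \<open>xs\<close> of maximal length is added last: by triangularity, the coefficient at its monomial
  vanishes for all other members of \<open>A\<close>, so that a multiple of it corrects the value at \<open>xs\<close> alone.
\<close>

lemma power_sum_dual:
  fixes h :: "nat list \<Rightarrow> rat"
  assumes "A \<subseteq> partitions n"
  shows "\<exists>K w. finite K \<and> (\<forall>xs\<in>A. (\<Sum>m\<in>K. w m * power_sum xs m) = h xs)"
proof -
  have "finite A" using assms finite_partitions finite_subset by blast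
  then show ?thesis using assms
  proof (induction A rule: finite_psubset_induct)
    case (psubset A)
    show ?case
    proof (cases "A = {}")
      case False
      then have "Max (length ` A) \<in> length ` A"
        using psubset.hyps by (intro Max_in) auto
      then obtain xs where xs: "xs \<in> A" "length xs = Max (length ` A)" by force
      then have max: "length ys \<le> length xs" if "ys \<in> A" for ys
        using that psubset.hyps by simp
      have no0: "0 \<notin> set ys" if "ys \<in> A" for ys
        using that psubset.prems by (auto simp: partitions_def)
      let ?x = "block_monomial xs Suc"
      have zero: "power_sum ys ?x = 0" if "ys \<in> A - {xs}" for ys
      proof (rule ccontr)
        assume "power_sum ys ?x \<noteq> 0"
        then have "mset ys = mset xs"
          using that xs no0 max by (intro power_sum_triangular) auto
        then show False
          using partition_eq_if_mset_eq[of ys n xs] that xs psubset.prems by auto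
      qed
      obtain K w where K: "finite K"
        and w: "\<forall>ys\<in>A - {xs}. (\<Sum>m\<in>K. w m * power_sum ys m) = h ys"
        using psubset.IH[of "A - {xs}"] psubset.prems xs by auto
      define d where "d = (h xs - (\<Sum>m\<in>K. w m * power_sum xs m)) / power_sum xs ?x"
      define w' where "w' m = (if m \<in> K then w m else 0) + (if m = ?x then d else 0)" for m
      have eval: "(\<Sum>m\<in>insert ?x K. w' m * power_sum ys m)
          = (\<Sum>m\<in>K. w m * power_sum ys m) + d * power_sum ys ?x" for ys
      proof -
        have "(\<Sum>m\<in>insert ?x K. w' m * power_sum ys m)
            = (\<Sum>m\<in>insert ?x K. if m \<in> K then w m * power_sum ys m else 0)
              + (\<Sum>m\<in>insert ?x K. if m = ?x then d * power_sum ys m else 0)"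
          unfolding sum.distrib[symmetric] by (intro sum.cong) (auto simp: w'_def algebra_simps)
        also have "(\<Sum>m\<in>insert ?x K. if m \<in> K then w m * power_sum ys m else 0)
            = (\<Sum>m\<in>K. w m * power_sum ys m)"
          using K by (intro sum.mono_neutral_cong_right) auto
        finally show ?thesis using K by (simp add: sum.delta)
      qed
      have "(\<Sum>m\<in>insert ?x K. w' m * power_sum ys m) = h ys" if "ys \<in> A" for ys
      proof (cases "ys = xs")
        case True
        have "power_sum xs ?x \<noteq> 0" using power_sum_Suc_nonzero no0 xs(1) by blast
        then show ?thesis unfolding True eval d_def by simp
      next
        case False
        then show ?thesis using w zero[of ys] that unfolding eval by simp
      qed
      then show ?thesis
        using K by (intro exI[of _ "insert ?x K"] exI[of _ w']) auto
    qed auto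
  qed
qed


section \<open>Edge subsets and their blocks\<close>

definition linked :: "'a set set \<Rightarrow> 'a \<Rightarrow> 'a \<Rightarrow> bool" where
  "linked S = (\<lambda>u v. {u, v} \<in> S)\<^sup>*\<^sup>*"

lemma linked_refl [simp]: "linked S v v"
  by (simp add: linked_def)

lemma linked_edge: "{u, v} \<in> S \<Longrightarrow> linked S u v"
  by (auto simp: linked_def)

lemma linked_trans: "linked S u v \<Longrightarrow> linked S v w \<Longrightarrow> linked S u w"
  unfolding linked_def by (rule rtranclp_trans)

lemma linked_sym: "linked S u v \<Longrightarrow> linked S v u"
  unfolding linked_def
  by (rule sympD[OF symp_rtranclp]) (auto simp: symp_def insert_commute)

lemma linked_mono: "linked S u v \<Longrightarrow> S \<subseteq> S' \<Longrightarrow> linked S' u v"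
  unfolding linked_def by (rule rtranclp_mono[THEN predicate2D]) auto

lemma linked_induct [consumes 1, case_names refl step]:
  assumes "linked S u v" "P u"
    and "\<And>a b. linked S u a \<Longrightarrow> {a, b} \<in> S \<Longrightarrow> P a \<Longrightarrow> P b"
  shows "P v"
  using assms(1) unfolding linked_def
  by (induction rule: rtranclp_induct) (use assms(2,3) in \<open>auto simp: linked_def\<close>)

definition block :: "'a set \<Rightarrow> 'a set set \<Rightarrow> 'a \<Rightarrow> 'a set" where
  "block V S v = {w \<in> V. linked S v w}"

definition blocks :: "'a set \<Rightarrow> 'a set set \<Rightarrow> 'a set set" where
  "blocks V S = block V S ` V"

lemma block_eq_iff:
  assumes "u \<in> V" "v \<in> V"
  shows "block V S u = block V S v \<longleftrightarrow> linked S u v"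
proof
  assume "block V S u = block V S v"
  moreover have "v \<in> block V S v" using assms by (simp add: block_def)
  ultimately have "v \<in> block V S u" by blast
  then show "linked S u v" by (simp add: block_def)
next
  assume "linked S u v"
  then show "block V S u = block V S v"
    by (auto simp: block_def intro: linked_trans linked_sym)
qed

lemma in_block_iff:
  assumes "B \<in> blocks V S" "v \<in> V"
  shows "v \<in> B \<longleftrightarrow> block V S v = B"
proof -
  obtain u where u: "u \<in> V" "B = block V S u" using assms(1) by (auto simp: blocks_def)
  then have "v \<in> B \<longleftrightarrow> linked S u v" using assms(2) by (simp add: block_def)
  then show ?thesis
    using u assms(2) block_eq_iff[of u V v S] by auto
qed

lemma blocks_subset: "B \<in> blocks V S \<Longrightarrow> B \<subseteq> V"
  by (auto simp: blocks_def block_def)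

lemma finite_blocks: "finite V \<Longrightarrow> finite (blocks V S)"
  by (simp add: blocks_def)

text \<open>
  Every block is the block of each of its \<open>card B\<close> vertices. With suitable \<open>g\<close>, this yields the total
  of the block sizes, the total of their squares and the number of singleton blocks.
\<close>

lemma sum_over_blocks:
  fixes g :: "'a set \<Rightarrow> 'b :: comm_semiring_1"
  assumes "finite V"
  shows "(\<Sum>v\<in>V. g (block V S v)) = (\<Sum>B\<in>blocks V S. of_nat (card B) * g B)"
proof -
  have "(\<Sum>v\<in>V. g (block V S v)) = (\<Sum>B\<in>blocks V S. \<Sum>v\<in>{v\<in>V. block V S v = B}. g (block V S v))"
    using assms unfolding blocks_def by (rule sum.image_gen)
  also have "\<dots> = (\<Sum>B\<in>blocks V S. \<Sum>v\<in>B. g B)"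
  proof (rule sum.cong[OF refl])
    fix B assume "B \<in> blocks V S"
    then have "{v \<in> V. block V S v = B} = B" and "\<And>v. v \<in> B \<Longrightarrow> block V S v = B"
      using in_block_iff[of B V S] blocks_subset[of B V S] by auto
    then show "(\<Sum>v\<in>{v \<in> V. block V S v = B}. g (block V S v)) = (\<Sum>v\<in>B. g B)"
      by simp
  qed
  finally show ?thesis by simp
qed

text \<open>
  Sizes are listed in decreasing order, so that they are an element of \<open>partitions\<close>.
\<close>

definition block_sizes :: "'a set \<Rightarrow> 'a set set \<Rightarrow> nat list" where
  "block_sizes V S = rev (sorted_list_of_multiset (image_mset card (mset_set (blocks V S))))"

lemma sum_block_sizes:
  fixes \<phi> :: "nat \<Rightarrow> 'b :: comm_monoid_add"
  shows "(\<Sum>x\<leftarrow>block_sizes V S. \<phi> x) = (\<Sum>B\<in>blocks V S. \<phi> (card B))"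
proof -
  have "(\<Sum>x\<leftarrow>block_sizes V S. \<phi> x) = sum_mset (mset (map \<phi> (block_sizes V S)))"
    by (simp only: sum_mset_sum_list)
  also have "\<dots> = sum_mset (image_mset (\<lambda>B. \<phi> (card B)) (mset_set (blocks V S)))"
    by (simp add: block_sizes_def multiset.map_comp comp_def)
  finally show ?thesis
    by (simp add: sum_unfold_sum_mset)
qed

lemma block_sizes_partition:
  assumes "finite V"
  shows "block_sizes V S \<in> partitions (card V)"
proof -
  have "sorted_wrt (\<ge>) (block_sizes V S)"
    unfolding block_sizes_def sorted_wrt_rev by (simp add: sorted_sorted_list_of_multiset)
  moreover have "0 \<notin> set (block_sizes V S)"
  proof
    assume "0 \<in> set (block_sizes V S)"
    then obtain B where "B \<in> blocks V S" "card B = 0"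
      using finite_blocks[OF assms, of S] by (auto simp: block_sizes_def)
    moreover from this obtain v where "v \<in> V" "B = block V S v"
      by (auto simp: blocks_def)
    ultimately show False
      using assms by (auto simp: block_def)
  qed
  moreover have "sum_list (block_sizes V S) = card V"
    using sum_block_sizes[of "\<lambda>x. x" V S] sum_over_blocks[OF assms, of "\<lambda>_. 1 :: nat" S] by simp
  ultimately show ?thesis by (simp add: partitions_def)
qed

lemma block_enumeration:
  assumes "finite V"
  obtains bs where "distinct bs" "set bs = blocks V S" "map card bs = block_sizes V S"
proof -
  obtain cs where cs: "distinct cs" "set cs = blocks V S"
    using finite_distinct_list[OF finite_blocks[OF assms]] by blast
  have "mset cs = mset_set (blocks V S)"
    using cs by (metis mset_set_set)
  then have "map card (sort_key card cs) = sorted_list_of_multiset (image_mset card (mset_set (blocks V S)))"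
    by (metis mset_map mset_sort sorted_sort_key sorted_list_of_multiset_mset properties_for_sort)
  show thesis
    by (rule that[of "rev (sort_key card cs)"]) (use cs in \<open>simp_all add: block_sizes_def rev_map[symmetric] \<open>map card (sort_key card cs) = _\<close>\<close>)
qed

definition constant_on_edges :: "'a set set \<Rightarrow> ('a \<Rightarrow> nat) \<Rightarrow> bool" where
  "constant_on_edges S \<kappa> \<longleftrightarrow> (\<forall>u v. {u, v} \<in> S \<longrightarrow> \<kappa> u = \<kappa> v)"

lemma constant_on_edges_linked:
  assumes "constant_on_edges S \<kappa>" "linked S u v"
  shows "\<kappa> u = \<kappa> v"
  using assms(2) by (induction rule: linked_induct) (use assms(1) in \<open>auto simp: constant_on_edges_def\<close>)

text \<open>
  A colouring that is constant on the edges in \<open>S\<close> is a free choice of one colour for each block, and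
  a colour chosen for the block \<open>B\<close> occurs \<open>card B\<close> times. This is the expansion of the product of the
  power sums \<open>p\<^bsub>card B\<^esub>\<close>.
\<close>

lemma power_sum_block_sizes:
  assumes V: "finite V" and S: "\<And>e. e \<in> S \<Longrightarrow> e \<subseteq> V"
  shows "power_sum (block_sizes V S) m
       = of_nat (card {\<kappa> \<in> V \<rightarrow>\<^sub>E {1..}. constant_on_edges S \<kappa> \<and> image_mset \<kappa> (mset_set V) = m})"
proof -
  obtain bs where bs: "distinct bs" "set bs = blocks V S" "map card bs = block_sizes V S"
    using block_enumeration[OF V] .
  let ?k = "length bs"
  have k: "length (block_sizes V S) = ?k" using bs(3) by (metis length_map)
  have nth: "block_sizes V S ! i = card (bs ! i)" if "i < ?k" for i
    using that bs(3) by (metis nth_map)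
  \<comment> \<open>The bijection composes a colour choice with \<open>idx\<close>, the index of the block of a vertex; it is inverted by evaluation at representatives \<open>rep\<close>.\<close>
  have "\<exists>i<?k. bs ! i = block V S v" if "v \<in> V" for v
    using that bs(2) by (metis blocks_def imageI in_set_conv_nth)
  then obtain idx where idx: "\<And>v. v \<in> V \<Longrightarrow> idx v < ?k" "\<And>v. v \<in> V \<Longrightarrow> bs ! idx v = block V S v"
    by metis
  have "\<exists>v\<in>V. bs ! i = block V S v" if "i < ?k" for i
    using that bs(2) nth_mem[of i bs] by (auto simp: blocks_def)
  then obtain rep where rep: "\<And>i. i < ?k \<Longrightarrow> rep i \<in> V" "\<And>i. i < ?k \<Longrightarrow> bs ! i = block V S (rep i)"
    by metis
  have idx_rep: "idx (rep i) = i" if "i < ?k" for i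
    using that idx rep bs(1) by (metis nth_eq_iff_index_eq)
  have rep_idx: "linked S (rep (idx v)) v" if "v \<in> V" for v
    using that idx[of v] rep[of "idx v"] block_eq_iff by metis
  have idx_edge: "idx u = idx v" if "{u, v} \<in> S" for u v
  proof -
    have uv: "u \<in> V" "v \<in> V" using S[OF that] by auto
    then have "bs ! idx u = bs ! idx v"
      using that idx(2) block_eq_iff[of u V v S] linked_edge by metis
    then show ?thesis using bs(1) idx(1) uv by (metis nth_eq_iff_index_eq)
  qed
  have fibre: "{v \<in> V. idx v = i} = bs ! i" if "i < ?k" for i
  proof -
    have B: "bs ! i \<in> blocks V S" using that bs(2) by (metis nth_mem)
    have "idx v = i \<longleftrightarrow> v \<in> bs ! i" if "v \<in> V" for v
      using that idx[of v] in_block_iff[OF B that] \<open>i < ?k\<close> bs(1) by (metis nth_eq_iff_index_eq)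
    then show ?thesis using blocks_subset[OF B] by auto
  qed
  have monomial: "image_mset (\<lambda>v. f (idx v)) (mset_set V) = block_monomial (block_sizes V S) f" for f
  proof (rule multiset_eqI)
    fix c
    let ?I = "{i. i < ?k \<and> f i = c}"
    have "{v \<in> V. f (idx v) = c} = (\<Union>i\<in>?I. {v \<in> V. idx v = i})"
      using idx(1) by auto
    then have "card {v \<in> V. f (idx v) = c} = (\<Sum>i\<in>?I. card {v \<in> V. idx v = i})"
      using V by (simp only:) (intro card_UN_disjoint; auto)
    also have "\<dots> = (\<Sum>i\<in>?I. card (bs ! i))"
      by (intro sum.cong refl) (simp add: fibre)
    also have "\<dots> = (\<Sum>i\<in>?I. block_sizes V S ! i)"
      by (intro sum.cong refl) (simp add: nth)
    finally have "card {v \<in> V. f (idx v) = c} = count (block_monomial (block_sizes V S) f) c"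
      unfolding count_block_monomial k .
    moreover have "count (image_mset (\<lambda>v. f (idx v)) (mset_set V)) c = card {v \<in> V. f (idx v) = c}"
      using V by (simp add: count_image_mset' eq_commute)
    ultimately show "count (image_mset (\<lambda>v. f (idx v)) (mset_set V)) c
        = count (block_monomial (block_sizes V S) f) c" by simp
  qed
  let ?F = "{f \<in> {..<?k} \<rightarrow>\<^sub>E {1..}. block_monomial (block_sizes V S) f = m}"
  let ?K = "{\<kappa> \<in> V \<rightarrow>\<^sub>E {1..}. constant_on_edges S \<kappa> \<and> image_mset \<kappa> (mset_set V) = m}"
  let ?to = "\<lambda>f. restrict (\<lambda>v. f (idx v)) V" and ?from = "\<lambda>\<kappa>. restrict (\<lambda>i. \<kappa> (rep i)) {..<?k}"
  have restrict_mset: "image_mset (restrict g V) (mset_set V) = image_mset g (mset_set V)"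
    for g :: "'a \<Rightarrow> nat"
    by (rule image_mset_cong) (use V in simp)
  have left: "?from (?to f) = f" if "f \<in> ?F" for f
  proof (rule ext)
    fix i show "?from (?to f) i = f i"
      using that rep(1)[of i] idx_rep[of i] by (cases "i < ?k") (auto simp: PiE_iff extensional_def)
  qed
  have right: "?to (?from \<kappa>) = \<kappa>" if "\<kappa> \<in> ?K" for \<kappa>
  proof (rule ext)
    fix v
    have "constant_on_edges S \<kappa>" using that by simp
    then have "\<kappa> (rep (idx v)) = \<kappa> v" if "v \<in> V"
      using rep_idx[OF that] by (rule constant_on_edges_linked)
    then show "?to (?from \<kappa>) v = \<kappa> v"
      using that idx(1)[of v] by (cases "v \<in> V") (auto simp: PiE_iff extensional_def)
  qed
  have to: "?to f \<in> ?K" if "f \<in> ?F" for f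
  proof -
    have "?to f \<in> V \<rightarrow>\<^sub>E {1..}" using that idx(1) by (auto simp: PiE_iff)
    moreover have "constant_on_edges S (?to f)"
      using idx_edge S by (auto simp: constant_on_edges_def)
    ultimately show ?thesis
      using that monomial[of f] by (simp add: restrict_mset)
  qed
  have from': "?from \<kappa> \<in> ?F" if "\<kappa> \<in> ?K" for \<kappa>
  proof -
    have "?from \<kappa> \<in> {..<?k} \<rightarrow>\<^sub>E {1..}" using that rep(1) by (auto simp: PiE_iff)
    moreover have "block_monomial (block_sizes V S) (?from \<kappa>) = image_mset (?to (?from \<kappa>)) (mset_set V)"
      by (simp only: monomial restrict_mset)
    ultimately show ?thesis
      using that right[OF that] by simp
  qed
  have "bij_betw ?to ?F ?K"
    by (rule bij_betw_byWitness[of _ ?from]) (use left right to from' in blast)+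
  then have "card ?F = card ?K" by (rule bij_betw_same_card)
  then show ?thesis unfolding power_sum_def k by simp
qed

section \<open>The expansion of the chromatic symmetric function into power sums\<close>

text \<open>
  The alternating sum over the subsets of the set of monochromatic edges of a colouring is \<open>1\<close> if the
  colouring is proper and \<open>0\<close> otherwise. Exchanging the sums over colourings and edge subsets gives
  this expansion, which is due to Stanley.
\<close>

theorem chromatic_sf_power_sums:
  assumes "simple_graph G"
  shows "chromatic_sf G m
       = (\<Sum>S\<in>Pow (edges G). (-1) ^ card S * power_sum (block_sizes (verts G) S) m)"
proof -
  let ?V = "verts G" and ?E = "edges G"
  have V: "finite ?V" and E: "\<And>e. e \<in> ?E \<Longrightarrow> e \<subseteq> ?V" and two: "\<And>e. e \<in> ?E \<Longrightarrow> card e = 2"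
    using assms by (auto simp: simple_graph_def)
  have finE: "finite ?E"
    by (rule finite_subset[of _ "Pow ?V"]) (use E V in auto)
  let ?A = "{\<kappa> \<in> ?V \<rightarrow>\<^sub>E {1..}. image_mset \<kappa> (mset_set ?V) = m}"
  have finA: "finite ?A"
  proof (rule finite_subset)
    show "?A \<subseteq> ?V \<rightarrow>\<^sub>E set_mset m" using V by (auto simp: PiE_iff extensional_def)
    show "finite (?V \<rightarrow>\<^sub>E set_mset m)" using V by (simp add: finite_PiE)
  qed
  define mono where "mono \<kappa> = {e \<in> ?E. \<forall>u\<in>e. \<forall>v\<in>e. \<kappa> u = \<kappa> v}" for \<kappa> :: "'a \<Rightarrow> nat"
  have const_iff: "constant_on_edges S \<kappa> \<longleftrightarrow> S \<subseteq> mono \<kappa>" if "S \<subseteq> ?E" for S \<kappa>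
  proof -
    have edge: "(\<forall>u v. e = {u, v} \<longrightarrow> \<kappa> u = \<kappa> v) \<longleftrightarrow> (\<forall>u\<in>e. \<forall>v\<in>e. \<kappa> u = \<kappa> v)" if e: "e \<in> S" for e
    proof -
      obtain a b where "e = {a, b}" using two[of e] e \<open>S \<subseteq> ?E\<close> by (auto simp: card_2_iff)
      then show ?thesis by (auto simp: doubleton_eq_iff)
    qed
    have "constant_on_edges S \<kappa> \<longleftrightarrow> (\<forall>e\<in>S. \<forall>u v. e = {u, v} \<longrightarrow> \<kappa> u = \<kappa> v)"
      unfolding constant_on_edges_def by blast
    also have "\<dots> \<longleftrightarrow> (\<forall>e\<in>S. \<forall>u\<in>e. \<forall>v\<in>e. \<kappa> u = \<kappa> v)"
      using edge by (intro ball_cong refl)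
    also have "\<dots> \<longleftrightarrow> S \<subseteq> mono \<kappa>"
      using that unfolding mono_def by blast
    finally show ?thesis .
  qed
  have proper_iff: "\<kappa> \<in> proper_colourings G \<and> colouring_monomial G \<kappa> = m \<longleftrightarrow> \<kappa> \<in> ?A \<and> mono \<kappa> = {}" for \<kappa>
  proof -
    have "mono \<kappa> = {} \<longleftrightarrow> (\<forall>u\<in>?V. \<forall>v\<in>?V. adjacent G u v \<longrightarrow> \<kappa> u \<noteq> \<kappa> v)"
    proof
      assume "mono \<kappa> = {}"
      then show "\<forall>u\<in>?V. \<forall>v\<in>?V. adjacent G u v \<longrightarrow> \<kappa> u \<noteq> \<kappa> v"
        by (auto simp: mono_def adjacent_def)
    next
      assume proper: "\<forall>u\<in>?V. \<forall>v\<in>?V. adjacent G u v \<longrightarrow> \<kappa> u \<noteq> \<kappa> v"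
      show "mono \<kappa> = {}"
      proof (rule ccontr)
        assume "mono \<kappa> \<noteq> {}"
        then obtain e where e: "e \<in> ?E" "\<forall>u\<in>e. \<forall>v\<in>e. \<kappa> u = \<kappa> v" by (auto simp: mono_def)
        then obtain u v where "e = {u, v}" using two[of e] by (auto simp: card_2_iff)
        then show False using e proper E[of e] by (auto simp: adjacent_def)
      qed
    qed
    then show ?thesis by (auto simp: proper_colourings_def colouring_monomial_def)
  qed
  have "(\<Sum>S\<in>Pow ?E. (-1) ^ card S * power_sum (block_sizes ?V S) m)
      = (\<Sum>S\<in>Pow ?E. \<Sum>\<kappa>\<in>?A. if S \<subseteq> mono \<kappa> then (-1) ^ card S else 0)"
  proof (rule sum.cong[OF refl])
    fix S assume "S \<in> Pow ?E"
    then have S: "S \<subseteq> ?E" by simp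
    have "{\<kappa> \<in> ?V \<rightarrow>\<^sub>E {1..}. constant_on_edges S \<kappa> \<and> image_mset \<kappa> (mset_set ?V) = m}
        = {\<kappa> \<in> ?A. S \<subseteq> mono \<kappa>}"
      using const_iff[OF S] by auto
    moreover have "e \<subseteq> ?V" if "e \<in> S" for e using that S E by blast
    ultimately have "power_sum (block_sizes ?V S) m = of_nat (card {\<kappa> \<in> ?A. S \<subseteq> mono \<kappa>})"
      using power_sum_block_sizes[OF V, of S m] by simp
    moreover have "(\<Sum>\<kappa>\<in>?A. if S \<subseteq> mono \<kappa> then (-1) ^ card S else 0 :: rat)
        = (\<Sum>\<kappa>\<in>{\<kappa> \<in> ?A. S \<subseteq> mono \<kappa>}. (-1) ^ card S)"
      using finA by (intro sum.inter_filter[symmetric])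
    ultimately show "(-1) ^ card S * power_sum (block_sizes ?V S) m
        = (\<Sum>\<kappa>\<in>?A. if S \<subseteq> mono \<kappa> then (-1) ^ card S else 0)" by simp
  qed
  also have "\<dots> = (\<Sum>\<kappa>\<in>?A. \<Sum>S\<in>Pow ?E. if S \<subseteq> mono \<kappa> then (-1) ^ card S else 0)"
    by (rule sum.swap)
  also have "\<dots> = (\<Sum>\<kappa>\<in>?A. if mono \<kappa> = {} then 1 else 0)"
  proof (rule sum.cong[OF refl])
    fix \<kappa>
    have sub: "mono \<kappa> \<subseteq> ?E" by (auto simp: mono_def)
    have "(\<Sum>S\<in>Pow ?E. if S \<subseteq> mono \<kappa> then (-1) ^ card S else 0 :: rat)
        = (\<Sum>S\<in>Pow (mono \<kappa>). (-1) ^ card S)"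
      using finE sub by (intro sum.mono_neutral_cong_right) auto
    then show "(\<Sum>S\<in>Pow ?E. if S \<subseteq> mono \<kappa> then (-1) ^ card S else 0 :: rat) = (if mono \<kappa> = {} then 1 else 0)"
      using alternating_sum_one[of "mono \<kappa>"] finite_subset[OF sub finE] by simp
  qed
  also have "\<dots> = of_nat (card {\<kappa> \<in> ?A. mono \<kappa> = {}})"
    using finA by (subst sum.inter_filter[symmetric]) simp_all
  also have "{\<kappa> \<in> ?A. mono \<kappa> = {}} = {\<kappa> \<in> proper_colourings G. colouring_monomial G \<kappa> = m}"
    using proper_iff by blast
  finally show ?thesis by (simp add: chromatic_sf_def)
qed


section \<open>Forests\<close>

lemma linked_empty [simp]: "linked {} u v \<longleftrightarrow> u = v"
proof
  assume "linked {} u v" then show "u = v" by (induction rule: linked_induct) auto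
qed auto

lemma linked_isolated:
  assumes "linked S v w" "\<forall>e\<in>S. v \<notin> e"
  shows "w = v"
  using assms(1) by (induction rule: linked_induct) (use assms(2) in auto)

lemma linked_insertD:
  assumes "linked (insert {a, b} S) u v"
  shows "linked S u v \<or> (linked S u a \<and> linked S b v) \<or> (linked S u b \<and> linked S a v)"
  using assms
proof (induction rule: linked_induct)
  case (step x y)
  show ?case
  proof (cases "{x, y} \<in> S")
    case True
    then show ?thesis using step.IH linked_edge linked_trans by metis
  next
    case False
    then have "x = a \<and> y = b \<or> x = b \<and> y = a" using step.hyps by (auto simp: doubleton_eq_iff)
    then show ?thesis using step.IH linked_refl linked_sym linked_trans by metis
  qed
qed simp

text \<open>
  An edge between two blocks merges them and leaves all others unchanged.
\<close>

lemma card_blocks_insert: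
  assumes V: "finite V" and ab: "a \<in> V" "b \<in> V" and apart: "\<not> linked S a b"
  shows "card (blocks V S) = Suc (card (blocks V (insert {a, b} S)))"
proof -
  let ?A = "block V S a" and ?B = "block V S b" and ?S = "insert {a, b} S"
  have edge: "linked ?S a b" by (simp add: linked_edge)
  have mono: "linked ?S u v" if "linked S u v" for u v
    using that by (rule linked_mono) auto
  have block: "block V ?S v = (if block V S v \<in> {?A, ?B} then ?A \<union> ?B else block V S v)"
    if v: "v \<in> V" for v
  proof -
    have "linked ?S v w \<longleftrightarrow> (if linked S v a \<or> linked S v b then linked S a w \<or> linked S b w else linked S v w)" for w
    proof -
      have "linked ?S v w" if "linked S v a \<or> linked S v b" "linked S a w \<or> linked S b w"
        using that edge mono linked_sym linked_trans by metis
      moreover have "linked S v a \<or> linked S v b" "linked S a w \<or> linked S b w"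
        if "linked ?S v w" "\<not> linked S v w"
        using linked_insertD[OF that(1)] that(2) by auto
      moreover have "linked S a w \<or> linked S b w" if "linked S v w" "linked S v a \<or> linked S v b"
        using that linked_sym linked_trans by metis
      ultimately show ?thesis using mono by metis
    qed
    moreover have "block V S v \<in> {?A, ?B} \<longleftrightarrow> linked S v a \<or> linked S v b"
      using block_eq_iff v ab by (metis insert_iff singletonD)
    ultimately show ?thesis by (auto simp: block_def)
  qed
  have A: "?A \<in> blocks V S" and B: "?B \<in> blocks V S" using ab by (auto simp: blocks_def)
  have "?A \<noteq> ?B" using apart ab block_eq_iff by metis
  have new: "?A \<union> ?B \<notin> blocks V S"
  proof
    assume U: "?A \<union> ?B \<in> blocks V S"
    have "a \<in> ?A \<union> ?B" "b \<in> ?A \<union> ?B" using ab by (auto simp: block_def)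
    then have "?A = ?A \<union> ?B" "?B = ?A \<union> ?B"
      using iffD1[OF in_block_iff[OF U ab(1)]] iffD1[OF in_block_iff[OF U ab(2)]] by blast+
    then show False using \<open>?A \<noteq> ?B\<close> by blast
  qed
  have "blocks V ?S = (\<lambda>B. if B \<in> {?A, ?B} then ?A \<union> ?B else B) ` blocks V S"
    unfolding blocks_def image_image by (rule image_cong) (simp_all add: block)
  also have "\<dots> = insert (?A \<union> ?B) (blocks V S - {?A, ?B})"
    using A by auto
  finally have eq: "blocks V ?S = insert (?A \<union> ?B) (blocks V S - {?A, ?B})" .
  have fin: "finite (blocks V S)" using V by (rule finite_blocks)
  then have "card (blocks V ?S) = Suc (card (blocks V S - {?A, ?B}))"
    using new unfolding eq by simp
  also have "card (blocks V S - {?A, ?B}) = card (blocks V S) - 2"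
    using A B \<open>?A \<noteq> ?B\<close> by (subst card_Diff_subset) auto
  finally have "card (blocks V ?S) = Suc (card (blocks V S) - 2)" .
  moreover have "card {?A, ?B} \<le> card (blocks V S)"
    using A B fin by (intro card_mono) auto
  ultimately show ?thesis using \<open>?A \<noteq> ?B\<close> by simp
qed

text \<open>
  Acyclicity is stated as the property that every edge is a bridge. All later arguments delete edges
  and ask which vertices remain linked, and for this purpose bridges are more convenient than cycles.
\<close>

locale forest =
  fixes V :: "'a set" and E :: "'a set set"
  assumes finite_V: "finite V"
    and edge_subset: "e \<in> E \<Longrightarrow> e \<subseteq> V"
    and edge_card: "e \<in> E \<Longrightarrow> card e = 2"
    and bridge: "{a, b} \<in> E \<Longrightarrow> \<not> linked (E - {{a, b}}) a b"
begin

lemma finite_E: "finite E"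
  by (rule finite_subset[of _ "Pow V"]) (use edge_subset finite_V in auto)

lemma edge_obtain:
  assumes "e \<in> E"
  obtains a b where "e = {a, b}" "a \<noteq> b" "a \<in> V" "b \<in> V"
  using edge_card[OF assms] edge_subset[OF assms] by (auto simp: card_2_iff)

lemma card_blocks:
  assumes "S \<subseteq> E"
  shows "card (blocks V S) + card S = card V"
proof -
  have "finite S" using assms finite_E by (rule finite_subset)
  then show ?thesis using assms
  proof (induction S rule: finite_induct)
    case empty
    have "blocks V {} = (\<lambda>v. {v}) ` V" by (auto simp: blocks_def block_def)
    then show ?case by (simp add: card_image)
  next
    case (insert e S)
    from insert.prems have "e \<in> E" by simp
    then obtain a b where ab: "e = {a, b}" "a \<in> V" "b \<in> V" by (rule edge_obtain)
    have "S \<subseteq> E - {e}" using insert by auto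
    then have "\<not> linked S a b" using bridge[of a b] \<open>e \<in> E\<close> ab linked_mono by metis
    then have "card (blocks V S) = Suc (card (blocks V (insert e S)))"
      using card_blocks_insert[OF finite_V ab(2,3)] ab(1) by simp
    then show ?case using insert by simp
  qed
qed

text \<open>
  If deleting \<open>e\<close> separated \<open>u\<close> from \<open>v\<close> inside \<open>S\<close>, then one end of \<open>e\<close> would still be linked to \<open>u\<close>
  and the other to \<open>v\<close>. Together with the link from \<open>u\<close> to \<open>v\<close> in \<open>E - {e}\<close> this would link the ends
  of the bridge \<open>e\<close> without using \<open>e\<close>.
\<close>

lemma linked_delete_edge:
  assumes "S \<subseteq> E" "e \<in> S" "linked S u v" "linked (E - {e}) u v"
  shows "linked (S - {e}) u v"
proof (rule ccontr)
  assume not: "\<not> linked (S - {e}) u v"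
  have "e \<in> E" using assms by auto
  then obtain a b where ab: "e = {a, b}" by (rule edge_obtain)
  have "linked (insert {a, b} (S - {e})) u v" using assms ab by (simp add: insert_absorb)
  then consider "linked (S - {e}) u a" "linked (S - {e}) b v" | "linked (S - {e}) u b" "linked (S - {e}) a v"
    using linked_insertD not by metis
  moreover have "linked (E - {e}) x y" if "linked (S - {e}) x y" for x y
    using that by (rule linked_mono) (use assms(1) in blast)
  ultimately have "linked (E - {e}) a b"
    using assms(4) by cases (metis linked_sym linked_trans)+
  then show False using bridge[of a b] \<open>e \<in> E\<close> ab by simp
qed

text \<open>
  In a forest, these are the pairs of vertices that are joined by a path through all edges.
\<close>

definition separated_pairs :: "('a \<times> 'a) set" where
  "separated_pairs = {(u, v) \<in> V \<times> V. linked E u v \<and> (\<forall>e\<in>E. \<not> linked (E - {e}) u v)}"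

text \<open>
  If some edge \<open>e\<close> is dispensable for linking \<open>u\<close> to \<open>v\<close>, then the presence of \<open>e\<close> in \<open>S\<close> never
  decides whether \<open>S\<close> links them, and the subsets with and without \<open>e\<close> cancel. Otherwise only the full
  edge set can link \<open>u\<close> to \<open>v\<close>.
\<close>

lemma alternating_sum_linked:
  assumes "u \<in> V" "v \<in> V"
  shows "(\<Sum>S\<in>Pow E. (-1) ^ card S * of_bool (linked S u v))
       = (-1) ^ card E * (of_bool ((u, v) \<in> separated_pairs) :: rat)"
proof (cases "\<exists>e\<in>E. linked (E - {e}) u v")
  case True
  then obtain e where e: "e \<in> E" "linked (E - {e}) u v" by blast
  have same: "linked (insert e S) u v = linked S u v" if "S \<in> Pow (E - {e})" for S
  proof
    assume "linked (insert e S) u v"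
    moreover have "insert e S \<subseteq> E" "e \<in> insert e S" "insert e S - {e} = S"
      using that e(1) by auto
    ultimately show "linked S u v"
      using linked_delete_edge[of "insert e S" e u v] e(2) by simp
  next
    assume "linked S u v" then show "linked (insert e S) u v" by (rule linked_mono) auto
  qed
  have E: "insert e (E - {e}) = E" using e by auto
  have "(\<Sum>S\<in>Pow E. (-1) ^ card S * (of_bool (linked S u v) :: rat))
      = (\<Sum>S\<in>Pow (E - {e}). (-1) ^ card S * (of_bool (linked S u v) - of_bool (linked (insert e S) u v)))"
    by (rule alternating_sum_insert[of "E - {e}" e, unfolded E]) (use finite_E in auto)
  also have "\<dots> = 0"
    by (intro sum.neutral ballI) (simp add: same)
  finally have "(\<Sum>S\<in>Pow E. (-1) ^ card S * (of_bool (linked S u v) :: rat)) = 0" .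
  then show ?thesis using e by (auto simp: separated_pairs_def)
next
  case False
  have "(\<Sum>S\<in>Pow E. (-1) ^ card S * (of_bool (linked S u v) :: rat))
      = (\<Sum>S\<in>{E}. (-1) ^ card S * of_bool (linked S u v))"
  proof (rule sum.mono_neutral_right)
    show "\<forall>S\<in>Pow E - {E}. (-1) ^ card S * (of_bool (linked S u v) :: rat) = 0"
    proof
      fix S assume "S \<in> Pow E - {E}"
      then obtain e where "e \<in> E" "S \<subseteq> E - {e}" by blast
      then have "\<not> linked S u v" using False linked_mono by metis
      then show "(-1) ^ card S * (of_bool (linked S u v) :: rat) = 0" by simp
    qed
  qed (use finite_E in auto)
  also have "\<dots> = (-1) ^ card E * of_bool ((u, v) \<in> separated_pairs)"
    using False assms by (auto simp: separated_pairs_def)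
  finally show ?thesis .
qed

end

section \<open>The functional on forests\<close>

text \<open>
  The value prescribed on the product of the power sums \<open>p\<^sub>x\<close> for \<open>x\<close> in \<open>xs\<close>. It is the sum of
  \<open>k + k' - k k'\<close> over all pairs of factors \<open>p\<^bsub>k+1\<^esub>\<close>, \<open>p\<^bsub>k'+1\<^esub>\<close> with \<open>k, k' \<ge> 1\<close>, written in terms of
  \<open>s = \<Sum>k\<close>, the number of parts equal to \<open>1\<close> and the sum of the squares of the parts.
\<close>

definition nh_weight :: "nat \<Rightarrow> nat list \<Rightarrow> rat" where
  "nh_weight n xs = (let s = of_nat n - of_nat (length xs) in
     (of_nat n - 1) * s - 3 / 2 * s\<^sup>2 - s * (\<Sum>x\<leftarrow>xs. of_bool (x = 1))
     + ((\<Sum>x\<leftarrow>xs. (of_nat x)\<^sup>2) - of_nat n - s) / 2)"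

context forest
begin

lemma card_block_1_iff:
  assumes "v \<in> V" "S \<subseteq> E"
  shows "card (block V S v) = 1 \<longleftrightarrow> S \<subseteq> {e \<in> E. v \<notin> e}"
proof -
  have v: "v \<in> block V S v" using assms by (simp add: block_def)
  have "card (block V S v) = 1 \<longleftrightarrow> block V S v = {v}"
    using v by (auto simp: card_1_singleton_iff)
  also have "\<dots> \<longleftrightarrow> (\<forall>e\<in>S. v \<notin> e)"
  proof
    assume single: "block V S v = {v}"
    show "\<forall>e\<in>S. v \<notin> e"
    proof (intro ballI notI)
      fix e assume e: "e \<in> S" "v \<in> e"
      then have "e \<in> E" using assms by auto
      then obtain a b where "e = {a, b}" "a \<noteq> b" "a \<in> V" "b \<in> V" by (rule edge_obtain)
      then obtain w where "e = {v, w}" "w \<noteq> v" "w \<in> V" using e by auto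
      then have "w \<in> block V S v" using e by (simp add: block_def linked_edge)
      then show False using single \<open>w \<noteq> v\<close> by simp
    qed
  next
    assume none: "\<forall>e\<in>S. v \<notin> e"
    have "w = v" if "linked S v w" for w
      using linked_isolated[OF that none] .
    then show "block V S v = {v}" using assms by (auto simp: block_def)
  qed
  finally show ?thesis using assms(2) by blast
qed

text \<open>
  In a forest the number of blocks is \<open>card V - card S\<close>, so that \<open>s\<close> becomes the number of edges.
  Singleton blocks are vertices missed by all edges in \<open>S\<close>, and the squares of the block sizes count
  linked pairs of vertices.
\<close>

lemma nh_weight_block_sizes:
  assumes "S \<subseteq> E"
  shows "nh_weight (card V) (block_sizes V S)
       = (of_nat (card V) - 1) * of_nat (card S) - 3 / 2 * (of_nat (card S))\<^sup>2
         - of_nat (card S) * (\<Sum>v\<in>V. of_bool (S \<subseteq> {e \<in> E. v \<notin> e}))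
         + ((\<Sum>u\<in>V. \<Sum>v\<in>V. of_bool (linked S u v)) - of_nat (card V) - of_nat (card S)) / 2"
proof -
  have "length (block_sizes V S) = card (blocks V S)"
    using sum_block_sizes[of "\<lambda>_. 1 :: nat" V S] by (simp add: sum_list_triv)
  then have "length (block_sizes V S) + card S = card V"
    using card_blocks[OF assms] by simp
  then have len: "of_nat (card V) - of_nat (length (block_sizes V S)) = (of_nat (card S) :: rat)"
    by (metis add_diff_cancel_left' of_nat_add)
  have "(\<Sum>x\<leftarrow>block_sizes V S. of_bool (x = 1)) = (\<Sum>B\<in>blocks V S. of_nat (card B) * (of_bool (card B = 1) :: rat))"
    unfolding sum_block_sizes by (intro sum.cong) auto
  also have "\<dots> = (\<Sum>v\<in>V. of_bool (card (block V S v) = 1))"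
    using sum_over_blocks[OF finite_V, of "\<lambda>B. of_bool (card B = 1) :: rat" S] by simp
  also have "\<dots> = (\<Sum>v\<in>V. of_bool (S \<subseteq> {e \<in> E. v \<notin> e}))"
    by (intro sum.cong refl) (simp only: card_block_1_iff[OF _ assms])
  finally have ones: "(\<Sum>x\<leftarrow>block_sizes V S. of_bool (x = 1)) = (\<Sum>v\<in>V. of_bool (S \<subseteq> {e \<in> E. v \<notin> e}) :: rat)" .
  have "(\<Sum>x\<leftarrow>block_sizes V S. (of_nat x)\<^sup>2) = (\<Sum>B\<in>blocks V S. of_nat (card B) * (of_nat (card B) :: rat))"
    unfolding sum_block_sizes by (simp add: power2_eq_square)
  also have "\<dots> = (\<Sum>u\<in>V. of_nat (card (block V S u)))"
    using sum_over_blocks[OF finite_V, of "\<lambda>B. of_nat (card B) :: rat" S] by simp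
  also have "\<dots> = (\<Sum>u\<in>V. \<Sum>v\<in>V. of_bool (linked S u v))"
    unfolding block_def using finite_V by (simp add: Int_def)
  finally show ?thesis
    unfolding nh_weight_def Let_def len ones by simp
qed

definition hubs :: "'a set" where
  "hubs = {v \<in> V. card {e \<in> E. v \<notin> e} = 1}"

text \<open>
  For a fixed vertex \<open>v\<close> the sum runs over all subsets of the set of edges that miss \<open>v\<close>, and the
  alternating sum of the cardinalities vanishes unless there is exactly one such edge.
\<close>

lemma alternating_sum_hubs:
  "(\<Sum>S\<in>Pow E. (-1) ^ card S * (of_nat (card S) * (\<Sum>v\<in>V. of_bool (S \<subseteq> {e \<in> E. v \<notin> e})))) = - (of_nat (card hubs) :: rat)"
proof -
  have "(\<Sum>S\<in>Pow E. (-1) ^ card S * (of_nat (card S) * (\<Sum>v\<in>V. of_bool (S \<subseteq> {e \<in> E. v \<notin> e}))))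
      = (\<Sum>v\<in>V. \<Sum>S\<in>Pow E. (-1) ^ card S * (of_nat (card S) * (of_bool (S \<subseteq> {e \<in> E. v \<notin> e}) :: rat)))"
    unfolding sum_distrib_left by (rule sum.swap)
  also have "\<dots> = (\<Sum>v\<in>V. \<Sum>S\<in>Pow {e \<in> E. v \<notin> e}. (-1) ^ card S * of_nat (card S))"
    using finite_E by (intro sum.cong refl sum.mono_neutral_cong_right) auto
  also have "\<dots> = (\<Sum>v\<in>V. - of_bool (card {e \<in> E. v \<notin> e} = 1))"
    using finite_E by (intro sum.cong refl) (simp add: alternating_sum_card)
  also have "\<dots> = - of_nat (card hubs)"
    using finite_V by (simp add: sum_negf hubs_def Int_def)
  finally show ?thesis .
qed

lemma alternating_sum_linked_pairs:
  "(\<Sum>S\<in>Pow E. (-1) ^ card S * (\<Sum>u\<in>V. \<Sum>v\<in>V. of_bool (linked S u v)))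
     = (-1) ^ card E * (of_nat (card separated_pairs) :: rat)"
proof -
  have "(\<Sum>S\<in>Pow E. (-1) ^ card S * (\<Sum>u\<in>V. \<Sum>v\<in>V. of_bool (linked S u v)))
      = (\<Sum>S\<in>Pow E. \<Sum>p\<in>V \<times> V. (-1) ^ card S * (of_bool (linked S (fst p) (snd p)) :: rat))"
    by (simp add: sum_distrib_left sum.cartesian_product case_prod_beta)
  also have "\<dots> = (\<Sum>p\<in>V \<times> V. \<Sum>S\<in>Pow E. (-1) ^ card S * of_bool (linked S (fst p) (snd p)))"
    by (rule sum.swap)
  also have "\<dots> = (\<Sum>p\<in>V \<times> V. (-1) ^ card E * of_bool (p \<in> separated_pairs))"
    by (rule sum.cong[OF refl]) (auto simp: alternating_sum_linked)
  also have "\<dots> = (-1) ^ card E * of_nat (card ((V \<times> V) \<inter> separated_pairs))"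
    using finite_V by (simp add: sum_distrib_left[symmetric])
  also have "(V \<times> V) \<inter> separated_pairs = separated_pairs"
    by (auto simp: separated_pairs_def)
  finally show ?thesis .
qed

definition forest_nh :: rat where
  "forest_nh = (\<Sum>S\<in>Pow E. (-1) ^ card S * nh_weight (card V) (block_sizes V S))"

text \<open>
  The correction for forests with at most two edges comes from the terms of \<open>nh_weight\<close> that depend on
  the number of edges of \<open>S\<close> only: alternating sums of polynomials of degree at most two in \<open>card S\<close>
  vanish as soon as there are three edges.
\<close>

theorem forest_nh_eq:
  "forest_nh = of_nat (card hubs) + (-1) ^ card E * of_nat (card separated_pairs) / 2
     - (if card E = 0 then of_nat (card V) / 2 else if card E = 1 then of_nat (card V) - 3
        else if card E = 2 then 3 else 0)"
proof -
  let ?c = "\<lambda>S. of_nat (card S) :: rat" and ?n = "of_nat (card V) :: rat"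
  let ?h = "\<lambda>S. \<Sum>v\<in>V. of_bool (S \<subseteq> {e \<in> E. v \<notin> e}) :: rat"
    and ?l = "\<lambda>S. \<Sum>u\<in>V. \<Sum>v\<in>V. of_bool (linked S u v) :: rat"
  have "forest_nh = (\<Sum>S\<in>Pow E. (?n - 3 / 2) * ((-1) ^ card S * ?c S) - 3 / 2 * ((-1) ^ card S * (?c S)\<^sup>2)
      - (-1) ^ card S * (?c S * ?h S) + 1 / 2 * ((-1) ^ card S * ?l S) - ?n / 2 * (-1) ^ card S)"
    unfolding forest_nh_def
  proof (rule sum.cong[OF refl])
    fix S assume "S \<in> Pow E"
    then have S: "S \<subseteq> E" by simp
    show "(-1) ^ card S * nh_weight (card V) (block_sizes V S)
        = (?n - 3 / 2) * ((-1) ^ card S * ?c S) - 3 / 2 * ((-1) ^ card S * (?c S)\<^sup>2)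
      - (-1) ^ card S * (?c S * ?h S) + 1 / 2 * ((-1) ^ card S * ?l S) - ?n / 2 * (-1) ^ card S"
      unfolding nh_weight_block_sizes[OF S] by (simp add: field_simps)
  qed
  also have "\<dots> = (?n - 3 / 2) * (\<Sum>S\<in>Pow E. (-1) ^ card S * ?c S) - 3 / 2 * (\<Sum>S\<in>Pow E. (-1) ^ card S * (?c S)\<^sup>2)
      - (\<Sum>S\<in>Pow E. (-1) ^ card S * (?c S * ?h S)) + 1 / 2 * (\<Sum>S\<in>Pow E. (-1) ^ card S * ?l S)
      - ?n / 2 * (\<Sum>S\<in>Pow E. (-1) ^ card S)"
    by (simp only: sum.distrib sum_subtractf sum_distrib_left)
  also have "\<dots> = of_nat (card hubs) + (-1) ^ card E * of_nat (card separated_pairs) / 2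
     - (if card E = 0 then ?n / 2 else if card E = 1 then ?n - 3 else if card E = 2 then 3 else 0)"
    unfolding alternating_sum_hubs alternating_sum_linked_pairs
      alternating_sum_card[OF finite_E] alternating_sum_card_square[OF finite_E] alternating_sum_one[OF finite_E]
    using finite_E by (auto simp: field_simps)
  finally show ?thesis .
qed

end


section \<open>Paths\<close>

definition path_edges :: "'a list \<Rightarrow> 'a set set" where
  "path_edges xs = {{xs ! i, xs ! Suc i} | i. Suc i < length xs}"

lemma path_edges_step: "Suc i < length xs \<Longrightarrow> {xs ! i, xs ! Suc i} \<in> path_edges xs"
  by (auto simp: path_edges_def)

lemma path_edges_three: "path_edges [a, c, b] = {{a, c}, {c, b}}"
proof -
  have "path_edges [a, c, b] = (\<lambda>i. {[a, c, b] ! i, [a, c, b] ! Suc i}) ` {0, 1}"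
    unfolding path_edges_def by (intro set_eqI iffI) (force simp: less_Suc_eq)+
  then show ?thesis by simp
qed

lemma Union_path_edges:
  assumes "2 \<le> length xs"
  shows "\<Union> (path_edges xs) = set xs"
proof
  show "\<Union> (path_edges xs) \<subseteq> set xs" by (auto simp: path_edges_def)
  show "set xs \<subseteq> \<Union> (path_edges xs)"
  proof
    fix v assume "v \<in> set xs"
    then obtain i where i: "i < length xs" "v = xs ! i" by (auto simp: in_set_conv_nth)
    show "v \<in> \<Union> (path_edges xs)"
    proof (cases i)
      case 0
      then show ?thesis using i assms path_edges_step[of 0 xs] by auto
    next
      case (Suc j)
      then show ?thesis using i path_edges_step[of j xs] by auto
    qed
  qed
qed

lemma linked_segment:
  assumes "i \<le> j" "\<And>k. i \<le> k \<Longrightarrow> k < j \<Longrightarrow> {xs ! k, xs ! Suc k} \<in> S"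
  shows "linked S (xs ! i) (xs ! j)"
  using assms
proof (induction j rule: dec_induct)
  case (step j)
  then have "linked S (xs ! i) (xs ! j)" "{xs ! j, xs ! Suc j} \<in> S" by auto
  then show ?case using linked_edge linked_trans by metis
qed simp

lemma linked_path_edges:
  assumes "xs \<noteq> []"
  shows "linked (path_edges xs) (hd xs) (last xs)"
  unfolding hd_conv_nth[OF assms] last_conv_nth[OF assms]
  by (rule linked_segment) (auto simp: path_edges_def)

text \<open>
  A path is extended by one edge at a time; if the new end was visited before, the path is cut off
  there, which keeps it free of repetitions.
\<close>

lemma linked_imp_path:
  assumes "linked S u v"
  shows "\<exists>xs. distinct xs \<and> xs \<noteq> [] \<and> hd xs = u \<and> last xs = v \<and> path_edges xs \<subseteq> S"
  using assms
proof (induction rule: linked_induct)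
  case refl
  show ?case by (rule exI[of _ "[u]"]) (simp add: path_edges_def)
next
  case (step a b)
  then obtain xs where xs: "distinct xs" "xs \<noteq> []" "hd xs = u" "last xs = a" "path_edges xs \<subseteq> S" by blast
  show ?case
  proof (cases "b \<in> set xs")
    case True
    then obtain i where i: "i < length xs" "xs ! i = b" by (auto simp: in_set_conv_nth)
    let ?ys = "take (Suc i) xs"
    have "path_edges ?ys \<subseteq> path_edges xs"
      by (force simp: path_edges_def)
    moreover have "last ?ys = b"
      using i by (simp add: take_Suc_conv_app_nth)
    ultimately show ?thesis
      using xs i by (intro exI[of _ ?ys]) auto
  next
    case False
    have "path_edges (xs @ [b]) \<subseteq> insert {a, b} (path_edges xs)"
    proof
      fix e assume "e \<in> path_edges (xs @ [b])"
      then obtain k where k: "k < length xs" "e = {(xs @ [b]) ! k, (xs @ [b]) ! Suc k}"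
        by (auto simp: path_edges_def)
      show "e \<in> insert {a, b} (path_edges xs)"
      proof (cases "Suc k < length xs")
        case True
        then show ?thesis using k by (auto simp: path_edges_def nth_append)
      next
        case False
        then have "Suc k = length xs" using k by simp
        moreover from this have "xs ! k = a" using xs(2,4) by (metis diff_Suc_1 last_conv_nth)
        ultimately show ?thesis using k by (simp add: nth_append)
      qed
    qed
    then show ?thesis
      using xs False step.hyps by (intro exI[of _ "xs @ [b]"]) auto
  qed
qed

lemma path_edges_eqD:
  assumes "distinct xs" "Suc i < length xs" "Suc j < length xs" "{xs ! i, xs ! Suc i} = {xs ! j, xs ! Suc j}"
  shows "i = j"
proof -
  have "(xs ! i = xs ! j \<and> xs ! Suc i = xs ! Suc j) \<or> (xs ! i = xs ! Suc j \<and> xs ! Suc i = xs ! j)"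
    using assms(4) by (simp add: doubleton_eq_iff)
  then show ?thesis
    using assms(1-3) by (auto simp: nth_eq_iff_index_eq)
qed

lemma card_path_edges:
  assumes "distinct xs"
  shows "card (path_edges xs) = length xs - 1"
proof -
  have "path_edges xs = (\<lambda>i. {xs ! i, xs ! Suc i}) ` {..<length xs - 1}"
    by (auto simp: path_edges_def)
  moreover have "inj_on (\<lambda>i. {xs ! i, xs ! Suc i}) {..<length xs - 1}"
    by (rule inj_onI) (rule path_edges_eqD[OF assms], auto)
  ultimately show ?thesis by (simp add: card_image)
qed

lemma card_path_edges_at:
  assumes "distinct xs"
  shows "card {e \<in> path_edges xs. v \<in> e} \<le> 2"
proof (cases "v \<in> set xs")
  case True
  then obtain j where j: "j < length xs" "v = xs ! j" by (auto simp: in_set_conv_nth)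
  have "{e \<in> path_edges xs. v \<in> e} \<subseteq> {{xs ! j, xs ! Suc j}, {xs ! (j - 1), xs ! Suc (j - 1)}}"
  proof
    fix e assume "e \<in> {e \<in> path_edges xs. v \<in> e}"
    then obtain i where i: "Suc i < length xs" "e = {xs ! i, xs ! Suc i}" "v \<in> e"
      by (auto simp: path_edges_def)
    then have "j = i \<or> j = Suc i"
      using j assms by (auto simp: nth_eq_iff_index_eq)
    then show "e \<in> {{xs ! j, xs ! Suc j}, {xs ! (j - 1), xs ! Suc (j - 1)}}"
      using i by auto
  qed
  then have "card {e \<in> path_edges xs. v \<in> e} \<le> card {{xs ! j, xs ! Suc j}, {xs ! (j - 1), xs ! Suc (j - 1)}}"
    by (intro card_mono) auto
  also have "\<dots> \<le> 2" by (simp add: card_insert_if)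
  finally show ?thesis .
next
  case False
  then have none: "v \<notin> e" if "e \<in> path_edges xs" for e
    using that by (auto simp: path_edges_def)
  have empty: "{e \<in> path_edges xs. v \<in> e} = {}" using none by blast
  show ?thesis unfolding empty by simp
qed

context forest
begin

lemma separated_pairs_sym:
  assumes "(u, v) \<in> separated_pairs"
  shows "(v, u) \<in> separated_pairs"
proof -
  have "linked S v u = linked S u v" for S
    using linked_sym by metis
  then show ?thesis using assms by (simp add: separated_pairs_def)
qed

text \<open>
  A pair of vertices of a path remains linked when an edge outside the segment between them is deleted.
  So all edges lie in this segment, and it is the whole path. Conversely, the two ends are separated
  by every edge, because all edges are bridges.
\<close>

lemma separated_pairs_path:
  assumes xs: "distinct xs" "2 \<le> length xs" and E: "E = path_edges xs"
  shows "separated_pairs = {(hd xs, last xs), (last xs, hd xs)}"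
proof -
  let ?l = "length xs - 1"
  have ne: "xs \<noteq> []" using xs by auto
  have hd: "hd xs = xs ! 0" and last: "last xs = xs ! ?l"
    using ne by (simp_all add: hd_conv_nth last_conv_nth)
  have V: "set xs \<subseteq> V"
    using edge_subset unfolding Union_path_edges[OF xs(2), symmetric] E[symmetric] by blast
  have "\<not> linked (E - {e}) (hd xs) (last xs)" if e: "e \<in> E" for e
  proof
    assume ends: "linked (E - {e}) (hd xs) (last xs)"
    obtain i where i: "Suc i < length xs" "e = {xs ! i, xs ! Suc i}"
      using e by (auto simp: E path_edges_def)
    have other: "{xs ! k, xs ! Suc k} \<in> E - {e}" if "Suc k < length xs" "k \<noteq> i" for k
      using that path_edges_step[of k xs] path_edges_eqD[OF xs(1) that(1) i(1)] unfolding E i(2) by blast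
    have left: "linked (E - {e}) (hd xs) (xs ! i)"
      unfolding hd by (rule linked_segment[OF _ other]) (use i in auto)
    have right: "linked (E - {e}) (xs ! Suc i) (last xs)"
      unfolding last by (rule linked_segment[OF _ other]) (use i in auto)
    have "linked (E - {e}) (xs ! i) (xs ! Suc i)"
      using linked_trans[OF linked_sym[OF left] linked_trans[OF ends linked_sym[OF right]]] .
    then show False using bridge[of "xs ! i" "xs ! Suc i"] e i by simp
  qed
  moreover have "linked E (hd xs) (last xs)"
    unfolding E using ne by (rule linked_path_edges)
  moreover have "hd xs \<in> V" "last xs \<in> V"
    using V ne by auto
  ultimately have "(hd xs, last xs) \<in> separated_pairs"
    by (simp add: separated_pairs_def)
  moreover from this have "(last xs, hd xs) \<in> separated_pairs"
    by (rule separated_pairs_sym)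
  moreover have "(u, v) = (hd xs, last xs) \<or> (u, v) = (last xs, hd xs)" if uv: "(u, v) \<in> separated_pairs" for u v
  proof -
    have e0: "{xs ! 0, xs ! Suc 0} \<in> E" and el: "{xs ! (?l - 1), xs ! Suc (?l - 1)} \<in> E"
      using xs(2) path_edges_step[of _ xs] by (simp_all add: E)
    have linked: "linked E u v" and sep: "\<And>e. e \<in> E \<Longrightarrow> \<not> linked (E - {e}) u v"
      using uv by (auto simp: separated_pairs_def)
    have "u \<noteq> v" using sep[OF e0] by auto
    have on_path: "w \<in> set xs" if "w \<in> e" "e \<in> E" for w e
      using that by (auto simp: E path_edges_def)
    have "u \<in> set xs" "v \<in> set xs"
      using linked_isolated[OF linked] linked_isolated[OF linked_sym[OF linked]] \<open>u \<noteq> v\<close> on_path by blast+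
    then obtain i j where ij: "i < length xs" "u = xs ! i" "j < length xs" "v = xs ! j"
      by (auto simp: in_set_conv_nth)
    have between: "i \<le> k \<and> k < j \<or> j \<le> k \<and> k < i" if k: "Suc k < length xs" for k
    proof (rule ccontr)
      assume k': "\<not> (i \<le> k \<and> k < j \<or> j \<le> k \<and> k < i)"
      let ?e = "{xs ! k, xs ! Suc k}"
      have other: "{xs ! k', xs ! Suc k'} \<in> E - {?e}" if "Suc k' < length xs" "k' \<noteq> k" for k'
        using that path_edges_step[of k' xs] path_edges_eqD[OF xs(1) that(1) k] unfolding E by blast
      have "linked (E - {?e}) u v"
      proof (cases "i \<le> j")
        case True
        then show ?thesis unfolding ij
          by (rule linked_segment[OF _ other]) (use k' ij True in auto)
      next
        case False
        then have "linked (E - {?e}) v u" unfolding ij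
          by (intro linked_segment[OF _ other]) (use k' ij False in auto)
        then show ?thesis by (rule linked_sym)
      qed
      moreover have "?e \<in> E" using k by (auto simp: E path_edges_def)
      ultimately show False using sep by blast
    qed
    have "Suc 0 < length xs" "Suc (?l - 1) < length xs" using xs(2) by simp_all
    from between[OF this(1)] between[OF this(2)]
    have "i = 0 \<and> j = ?l \<or> j = 0 \<and> i = ?l"
      using xs(2) ij(1,3) by linarith
    then show ?thesis using ij hd last by auto
  qed
  ultimately show ?thesis by auto
qed

lemma card_separated_pairs_path:
  assumes "distinct xs" "2 \<le> length xs" "E = path_edges xs"
  shows "card separated_pairs = 2"
proof -
  have "hd xs \<noteq> last xs"
  proof -
    have "xs \<noteq> []" "0 < length xs - 1" using assms(2) by auto
    then show ?thesis
      using nth_eq_iff_index_eq[OF assms(1), of 0 "length xs - 1"] by (simp add: hd_conv_nth last_conv_nth)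
  qed
  then show ?thesis using separated_pairs_path[OF assms] by (simp add: card_insert_if)
qed

text \<open>
  A path from \<open>u\<close> to \<open>v\<close> must use every edge, as otherwise an unused edge could be deleted.
\<close>

lemma separated_pair_imp_path:
  assumes "(u, v) \<in> separated_pairs"
  obtains xs where "distinct xs" "E = path_edges xs"
proof -
  have linked: "linked E u v" and sep: "\<And>e. e \<in> E \<Longrightarrow> \<not> linked (E - {e}) u v"
    using assms by (auto simp: separated_pairs_def)
  obtain xs where xs: "distinct xs" "xs \<noteq> []" "hd xs = u" "last xs = v" "path_edges xs \<subseteq> E"
    using linked_imp_path[OF linked] by blast
  have "e \<in> path_edges xs" if "e \<in> E" for e
  proof (rule ccontr)
    assume "e \<notin> path_edges xs"
    then have "path_edges xs \<subseteq> E - {e}" using xs(5) by blast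
    then have "linked (E - {e}) u v"
      using linked_path_edges[OF xs(2)] linked_mono unfolding xs(3,4) by metis
    then show False using sep[OF that] by simp
  qed
  then show thesis using that xs(1,5) by blast
qed

text \<open>
  This lemma and the next evaluate forests with at most two edges. They are needed because star forests
  with few edges occur in the star basis; the only nonzero value is that of two disjoint edges, the
  star forest of \<open>221\<dots>1\<close>.
\<close>

lemma forest_nh_few_edges:
  assumes "card E < 2"
  shows "forest_nh = 0"
proof (cases "card E = 0")
  case True
  then have E: "E = {}" using finite_E by simp
  have "hubs = {}" unfolding hubs_def by (simp add: E)
  moreover have "separated_pairs = (\<lambda>v. (v, v)) ` V"
    unfolding separated_pairs_def by (auto simp: E)
  then have "card separated_pairs = card V" by (simp add: card_image inj_on_def)
  ultimately show ?thesis unfolding forest_nh_eq True by simp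
next
  case False
  then have E1: "card E = 1" using assms by simp
  then obtain e where E: "E = {e}" by (rule card_1_singletonE)
  then have "e \<in> E" by simp
  then obtain a b where ab: "e = {a, b}" "a \<noteq> b" "a \<in> V" "b \<in> V" by (rule edge_obtain)
  have "hubs = V - {a, b}"
  proof -
    have "{d \<in> E. v \<notin> d} = (if v \<in> {a, b} then {} else {e})" for v
      unfolding E ab(1) by auto
    then show ?thesis unfolding hubs_def by auto
  qed
  then have "card hubs = card V - 2" using ab finite_V by (simp add: card_Diff_subset)
  moreover have "2 \<le> card V" using ab finite_V card_mono[of V "{a, b}"] by simp
  moreover have "path_edges [a, b] = E" using E ab by (auto simp: path_edges_def)
  then have "card separated_pairs = 2"
    using ab by (intro card_separated_pairs_path[of "[a, b]"]) auto
  ultimately show ?thesis unfolding forest_nh_eq E1 by (simp add: of_nat_diff)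
qed

lemma forest_nh_two_edges:
  assumes "E = {e, f}" "e \<noteq> f"
  shows "forest_nh = of_bool (e \<inter> f = {})"
proof -
  have fin: "finite e" "finite f" and sub: "e \<union> f \<subseteq> V" and two: "card e = 2" "card f = 2"
    using edge_subset[of e] edge_subset[of f] edge_card[of e] edge_card[of f] finite_V assms(1)
    by (auto intro: finite_subset)
  have avoid: "{d \<in> E. v \<notin> d} = (if v \<in> e then {} else {e}) \<union> (if v \<in> f then {} else {f})" for v
    by (auto simp: assms(1))
  have "hubs = (e \<union> f) - (e \<inter> f)"
    unfolding hubs_def avoid using sub assms(2) by (auto simp: card_insert_if split: if_splits)
  moreover have "card ((e \<union> f) - (e \<inter> f)) = card (e \<union> f) - card (e \<inter> f)"
    by (rule card_Diff_subset) (use fin in auto)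
  ultimately have "card hubs = card (e \<union> f) - card (e \<inter> f)" by simp
  then have hubs: "card hubs = 4 - 2 * card (e \<inter> f)"
    using card_Un_Int[OF fin] two by simp
  have E2: "card E = 2" using assms by simp
  show ?thesis
  proof (cases "e \<inter> f = {}")
    case True
    have "separated_pairs = {}"
    proof (rule ccontr)
      assume "separated_pairs \<noteq> {}"
      then obtain u v where "(u, v) \<in> separated_pairs" by auto
      then obtain xs where xs: "distinct xs" "E = path_edges xs" by (rule separated_pair_imp_path)
      then have "length xs = 3" using card_path_edges[of xs] E2 by simp
      then obtain x y z where "xs = [x, y, z]"
        by (auto simp: numeral_3_eq_3 length_Suc_conv)
      then have "{e, f} = {{x, y}, {y, z}}"
        using xs(2) assms(1) by (simp add: path_edges_three)
      then have "y \<in> e \<inter> f" using assms(2) by (auto simp: doubleton_eq_iff)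
      then show False using True by simp
    qed
    then show ?thesis unfolding forest_nh_eq E2 hubs using True by simp
  next
    case False
    then obtain c where c: "c \<in> e" "c \<in> f" by blast
    then obtain a b where ab: "e = {c, a}" "f = {c, b}" "a \<noteq> c" "b \<noteq> c"
      using two by (auto simp: card_2_iff doubleton_eq_iff)
    then have "a \<noteq> b" using assms(2) by auto
    have "E = path_edges [a, c, b]"
      using ab assms(1) by (simp add: path_edges_three insert_commute)
    then have "card separated_pairs = 2"
      using ab \<open>a \<noteq> b\<close> by (intro card_separated_pairs_path[of "[a, c, b]"]) auto
    moreover have "e \<inter> f = {c}" using ab \<open>a \<noteq> b\<close> by auto
    ultimately show ?thesis unfolding forest_nh_eq E2 hubs by simp
  qed
qed

end

section \<open>Applying the functional to a star expansion\<close>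

text \<open>
  By the power sum expansion, the functional dual to \<open>nh_weight\<close> maps the chromatic symmetric function
  of a forest \<open>H\<close> to the value \<open>forest_nh\<close> of \<open>H\<close>. It is linear, so it may be applied to both sides of the
  star expansion.
\<close>

lemma star_expansion_forest_nh:
  assumes forest: "forest (verts G) (edges G)" and n: "card (verts G) = n"
    and stars: "\<And>\<mu>. \<mu> \<in> partitions n \<Longrightarrow> forest (verts (star_forest \<mu>)) (edges (star_forest \<mu>))"
    and cards: "\<And>\<mu>. \<mu> \<in> partitions n \<Longrightarrow> card (verts (star_forest \<mu>)) = n"
    and expansion: "star_expansion n (chromatic_sf G) c"
  shows "forest.forest_nh (verts G) (edges G)
       = (\<Sum>\<mu>\<in>partitions n. c \<mu> * forest.forest_nh (verts (star_forest \<mu>)) (edges (star_forest \<mu>)))"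
proof -
  obtain K w where w: "\<And>xs. xs \<in> partitions n \<Longrightarrow> (\<Sum>m\<in>K. w m * power_sum xs m) = nh_weight n xs"
    using power_sum_dual[of "partitions n" n "nh_weight n"] by blast
  have eval: "(\<Sum>m\<in>K. w m * chromatic_sf H m) = forest.forest_nh (verts H) (edges H)"
    if "forest (verts H) (edges H)" "card (verts H) = n" for H :: "'b graph"
  proof -
    interpret H: forest "verts H" "edges H" by fact
    have simple: "simple_graph H"
      unfolding simple_graph_def using H.finite_V H.edge_subset H.edge_card by blast
    have "(\<Sum>m\<in>K. w m * chromatic_sf H m)
        = (\<Sum>S\<in>Pow (edges H). \<Sum>m\<in>K. (-1) ^ card S * (w m * power_sum (block_sizes (verts H) S) m))"
      unfolding chromatic_sf_power_sums[OF simple] sum_distrib_left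
      by (subst sum.swap) (simp add: algebra_simps)
    also have "\<dots> = (\<Sum>S\<in>Pow (edges H). (-1) ^ card S * nh_weight n (block_sizes (verts H) S))"
      unfolding sum_distrib_left[symmetric]
      by (intro sum.cong refl arg_cong2[of _ _ _ _ "(*)"] w) (metis block_sizes_partition H.finite_V that(2))
    finally show ?thesis unfolding H.forest_nh_def that(2) .
  qed
  have "forest.forest_nh (verts G) (edges G) = (\<Sum>m\<in>K. w m * chromatic_sf G m)"
    using eval[OF forest n] by simp
  also have "\<dots> = (\<Sum>m\<in>K. w m * (\<Sum>\<mu>\<in>partitions n. c \<mu> * star_sf \<mu> m))"
    using expansion unfolding star_expansion_def by simp
  also have "\<dots> = (\<Sum>\<mu>\<in>partitions n. c \<mu> * (\<Sum>m\<in>K. w m * star_sf \<mu> m))"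
    unfolding sum_distrib_left by (subst sum.swap) (simp add: algebra_simps)
  also have "\<dots> = (\<Sum>\<mu>\<in>partitions n. c \<mu> * forest.forest_nh (verts (star_forest \<mu>)) (edges (star_forest \<mu>)))"
    unfolding star_sf_def using eval[OF stars cards] by simp
  finally show ?thesis .
qed


section \<open>Star forests\<close>

lemma verts_star_forest: "verts (star_forest \<mu>) = (SIGMA i:{..<length \<mu>}. {..<\<mu> ! i})"
  by (auto simp: star_forest_def disjoint_union_def star_graph_def)

lemma edges_star_forest:
  "edges (star_forest \<mu>) = (\<lambda>(i, j). {(i, 0), (i, j)}) ` (SIGMA i:{..<length \<mu>}. {1..<\<mu> ! i})"
proof (intro set_eqI iffI)
  fix e assume "e \<in> edges (star_forest \<mu>)"
  then obtain i d where "i < length \<mu>" "d \<in> edges (star_graph (\<mu> ! i))" "e = Pair i ` d"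
    by (auto simp: star_forest_def disjoint_union_def)
  moreover from this obtain j where "1 \<le> j" "j < \<mu> ! i" "d = {0, j}"
    by (auto simp: star_graph_def)
  ultimately show "e \<in> (\<lambda>(i, j). {(i, 0), (i, j)}) ` (SIGMA i:{..<length \<mu>}. {1..<\<mu> ! i})"
    by (intro image_eqI[of _ _ "(i, j)"]) auto
next
  fix e assume "e \<in> (\<lambda>(i, j). {(i, 0), (i, j)}) ` (SIGMA i:{..<length \<mu>}. {1..<\<mu> ! i})"
  then obtain i j where "i < length \<mu>" "1 \<le> j" "j < \<mu> ! i" "e = Pair i ` {0, j}"
    by auto
  moreover from this have "{0, j} \<in> edges (star_graph (\<mu> ! i))"
    by (auto simp: star_graph_def)
  ultimately show "e \<in> edges (star_forest \<mu>)"
    unfolding star_forest_def disjoint_union_def by (auto intro!: exI[of _ i] exI[of _ "{0, j}"])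
qed

lemma star_edgeE:
  assumes "e \<in> edges (star_forest \<mu>)"
  obtains i j where "e = {(i, 0), (i, j)}" "i < length \<mu>" "1 \<le> j" "j < \<mu> ! i"
  using assms by (auto simp: edges_star_forest)

lemma inj_star_edge: "inj_on (\<lambda>(i, j). {(i, 0), (i, j)}) (SIGMA i:{..<length \<mu>}. {1..<\<mu> ! i})"
  by (auto simp: inj_on_def doubleton_eq_iff)

lemma sum_list_nth: "(\<Sum>i<length xs. f (xs ! i)) = (\<Sum>x\<leftarrow>xs. f x)"
  by (simp add: sum_list_sum_nth atLeast0LessThan)

lemma card_verts_star_forest: "card (verts (star_forest \<mu>)) = sum_list \<mu>"
  using sum_list_nth[of "\<lambda>x. x" \<mu>] by (simp add: verts_star_forest)

lemma card_edges_star_forest: "card (edges (star_forest \<mu>)) = (\<Sum>x\<leftarrow>\<mu>. x - 1)"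
  unfolding edges_star_forest card_image[OF inj_star_edge]
  using sum_list_nth[of "\<lambda>x. x - 1" \<mu>] by simp

text \<open>
  Every edge is a bridge because it isolates its leaf when it is deleted.
\<close>

lemma forest_star_forest: "forest (verts (star_forest \<mu>)) (edges (star_forest \<mu>))"
proof
  let ?E = "edges (star_forest \<mu>)"
  show "finite (verts (star_forest \<mu>))" by (simp add: verts_star_forest)
  show "e \<subseteq> verts (star_forest \<mu>)" "card e = 2" if "e \<in> ?E" for e
    using that by (auto elim!: star_edgeE simp: verts_star_forest)
  fix a b assume ab: "{a, b} \<in> ?E"
  then obtain i j where ij: "{a, b} = {(i, 0), (i, j)}" "1 \<le> j" by (rule star_edgeE)
  have isolated: "(i, j) \<notin> e" if "e \<in> ?E - {{a, b}}" for e
    using that ij by (auto elim!: star_edgeE)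
  have "\<not> linked (?E - {{a, b}}) (i, j) (i, 0)"
    using linked_isolated[of "?E - {{a, b}}" "(i, j)" "(i, 0)"] isolated ij(2) by auto
  moreover have "a = (i, 0) \<and> b = (i, j) \<or> a = (i, j) \<and> b = (i, 0)"
    using ij(1) by (simp add: doubleton_eq_iff)
  ultimately show "\<not> linked (?E - {{a, b}}) a b"
    using linked_sym by metis
qed

interpretation stars: forest "verts (star_forest \<mu>)" "edges (star_forest \<mu>)" for \<mu>
  by (rule forest_star_forest)

lemma card_star_edges_avoiding:
  assumes "i < length \<mu>" "x < \<mu> ! i"
  shows "card {e \<in> edges (star_forest \<mu>). (i, x) \<notin> e}
       = card (edges (star_forest \<mu>)) - (if x = 0 then \<mu> ! i - 1 else 1)"
proof -
  let ?E = "edges (star_forest \<mu>)"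
  have "{e \<in> ?E. (i, x) \<in> e} = (\<lambda>j. {(i, 0), (i, j)}) ` (if x = 0 then {1..<\<mu> ! i} else {x})"
    using assms by (auto simp: edges_star_forest)
  moreover have "inj_on (\<lambda>j. {(i, 0), (i, j)}) A" for A :: "nat set"
    by (auto simp: inj_on_def doubleton_eq_iff)
  ultimately have "card {e \<in> ?E. (i, x) \<in> e} = (if x = 0 then \<mu> ! i - 1 else 1)"
    by (simp add: card_image)
  moreover have "{e \<in> ?E. (i, x) \<notin> e} = ?E - {e \<in> ?E. (i, x) \<in> e}" by auto
  then have "card {e \<in> ?E. (i, x) \<notin> e} = card ?E - card {e \<in> ?E. (i, x) \<in> e}"
    by (simp only:) (rule card_Diff_subset, use stars.finite_E in auto)
  ultimately show ?thesis by simp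
qed

text \<open>
  Two linked vertices lie in the same star and are linked by at most two edges, so a third edge can be
  deleted without separating them.
\<close>

lemma star_separated_pairs_empty:
  assumes "3 \<le> card (edges (star_forest \<mu>))"
  shows "stars.separated_pairs \<mu> = {}"
proof -
  let ?E = "edges (star_forest \<mu>)"
  have False if uv: "((i, x), (i', y)) \<in> stars.separated_pairs \<mu>" for i x i' y
  proof -
    have linked: "linked ?E (i, x) (i', y)" and sep: "\<And>e. e \<in> ?E \<Longrightarrow> \<not> linked (?E - {e}) (i, x) (i', y)"
      and V: "(i, x) \<in> verts (star_forest \<mu>)" "(i', y) \<in> verts (star_forest \<mu>)"
      using uv by (auto simp: stars.separated_pairs_def)
    have "fst (i', y) = fst (i, x)"
      using linked
    proof (induction rule: linked_induct)
      case (step a b)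
      then show ?case by (auto elim!: star_edgeE simp: doubleton_eq_iff)
    qed simp
    then have i': "i' = i" by simp
    let ?s = "\<lambda>z. {(i, 0), (i, z)}"
    have "card {?s x, ?s y} < card ?E"
      using assms by (simp add: card_insert_if)
    then obtain e where e: "e \<in> ?E" "e \<notin> {?s x, ?s y}"
      by (metis card_mono finite.emptyI finite.insertI leD subsetI)
    have centre: "linked (?E - {e}) (i, 0) (i, z)" if "(i, z) \<in> verts (star_forest \<mu>)" "e \<noteq> ?s z" for z
    proof (cases "z = 0")
      case False
      then have "?s z \<in> ?E" using that by (auto simp: edges_star_forest verts_star_forest)
      then show ?thesis using that by (intro linked_edge) auto
    qed simp
    have "linked (?E - {e}) (i, x) (i, y)"
      using linked_trans[OF linked_sym[OF centre] centre] V e(2) i' by auto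
    then show False using sep[OF e(1)] i' by simp
  qed
  then show ?thesis by auto
qed

text \<open>
  With \<open>m \<ge> 3\<close> edges, a leaf is missed by \<open>m - 1 \<ge> 2\<close> edges, and the centre of a star with \<open>k\<close> vertices
  by \<open>m - (k - 1)\<close>. Hence exactly the centres of stars with \<open>m\<close> vertices are counted.
\<close>

lemma forest_nh_star_forest_ge3:
  assumes "3 \<le> card (edges (star_forest \<mu>))"
  shows "stars.forest_nh \<mu> = of_nat (card {i. i < length \<mu> \<and> \<mu> ! i = card (edges (star_forest \<mu>))})"
proof -
  let ?m = "card (edges (star_forest \<mu>))"
  have "stars.hubs \<mu> = (\<lambda>i. (i, 0)) ` {i. i < length \<mu> \<and> \<mu> ! i = ?m}"
  proof (intro set_eqI)
    fix v :: "nat \<times> nat"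
    obtain i x where v: "v = (i, x)" by (cases v)
    have in_verts: "v \<in> verts (star_forest \<mu>) \<longleftrightarrow> i < length \<mu> \<and> x < \<mu> ! i"
      by (simp add: verts_star_forest v)
    have hub: "v \<in> stars.hubs \<mu> \<longleftrightarrow>
        v \<in> verts (star_forest \<mu>) \<and> card {e \<in> edges (star_forest \<mu>). v \<notin> e} = 1"
      by (simp only: stars.hubs_def mem_Collect_eq)
    show "v \<in> stars.hubs \<mu> \<longleftrightarrow> v \<in> (\<lambda>i. (i, 0)) ` {i. i < length \<mu> \<and> \<mu> ! i = ?m}"
    proof (cases "i < length \<mu> \<and> x < \<mu> ! i")
      case True
      then have "card {e \<in> edges (star_forest \<mu>). v \<notin> e} = ?m - (if x = 0 then \<mu> ! i - 1 else 1)"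
        unfolding v by (intro card_star_edges_avoiding) auto
      then have "v \<in> stars.hubs \<mu> \<longleftrightarrow> ?m - (if x = 0 then \<mu> ! i - 1 else 1) = 1"
        unfolding hub in_verts using True by simp
      then show ?thesis using True assms v by auto
    next
      case False
      then have "v \<notin> stars.hubs \<mu>" unfolding hub in_verts by blast
      then show ?thesis using False assms v by auto
    qed
  qed
  then have "card (stars.hubs \<mu>) = card {i. i < length \<mu> \<and> \<mu> ! i = ?m}"
    by (simp add: card_image inj_on_def)
  then show ?thesis
    using assms unfolding stars.forest_nh_eq star_separated_pairs_empty[OF assms] by simp
qed

lemma sum_pred_eq_0D:
  assumes "0 \<notin> set xs" "(\<Sum>x\<leftarrow>xs. x - 1) = (0 :: nat)"
  shows "xs = replicate (length xs) 1"
proof -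
  have "x = 1" if "x \<in> set xs" for x
  proof -
    have "x - 1 = 0" using assms(2) that by (auto simp: sum_list_eq_0_iff)
    moreover have "x \<noteq> 0" using assms(1) that by metis
    ultimately show ?thesis by simp
  qed
  then show ?thesis by (intro replicate_length_same[symmetric] ballI)
qed

lemma sum_pred_eq_1D:
  assumes "0 \<notin> set xs" "(\<Sum>x\<leftarrow>xs. x - 1) = (1 :: nat)"
  shows "mset xs = add_mset 2 (replicate_mset (length xs - 1) 1)"
  using assms
proof (induction xs)
  case (Cons x xs)
  then consider "x = 1" "(\<Sum>x\<leftarrow>xs. x - 1) = 1" | "x = 2" "(\<Sum>x\<leftarrow>xs. x - 1) = 0"
    by fastforce
  then show ?case
  proof cases
    case 1
    then have "xs \<noteq> []" by auto
    then show ?thesis using 1 Cons by (cases xs) auto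
  next
    case 2
    then have "xs = replicate (length xs) 1" using Cons.prems by (intro sum_pred_eq_0D) auto
    then show ?thesis using 2 by (metis mset.simps(2) mset_replicate diff_Suc_1 length_Cons)
  qed
qed simp

definition nh_partition :: "nat \<Rightarrow> nat \<Rightarrow> nat list" where
  "nh_partition n a = [a, 2] @ replicate (n - a - 2) 1"

lemma nh_partition_largest:
  assumes "3 \<le> a"
  shows "{i. i < length (nh_partition n a) \<and> nh_partition n a ! i = a} = {0}"
proof -
  have "i = 0" if "i < length (nh_partition n a)" "nh_partition n a ! i = a" for i
  proof (rule ccontr)
    assume "i \<noteq> 0"
    then obtain k where "i = Suc k" by (cases i) auto
    then show False using that assms by (cases k) (auto simp: nh_partition_def)
  qed
  then show ?thesis by (auto simp: nh_partition_def)
qed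

lemma nh_partition_in_partitions:
  assumes "a \<in> {2..n - 2}" "4 \<le> n"
  shows "nh_partition n a \<in> partitions n"
proof -
  have "sorted_wrt (\<ge>) (replicate k (1 :: nat))" for k
    by (simp add: sorted_wrt_iff_nth_less)
  then show ?thesis
    using assms by (auto simp: nh_partition_def partitions_def sum_list_replicate)
qed

text \<open>
  The star with \<open>m\<close> vertices has \<open>m - 1\<close> of the \<open>m\<close> edges. The one remaining edge makes up a star with
  two vertices, and all other stars are single vertices.
\<close>

lemma partition_with_part_eq_edges:
  assumes \<mu>: "\<mu> \<in> partitions n" and m: "m = (\<Sum>x\<leftarrow>\<mu>. x - 1)" "2 \<le> m" "m \<in> set \<mu>"
  shows "\<mu> = nh_partition n m" "m \<in> {2..n - 2}" "4 \<le> n"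
proof -
  let ?\<rho> = "remove1 m \<mu>"
  have pos: "0 \<notin> set \<mu>" and n: "sum_list \<mu> = n" using \<mu> by (auto simp: partitions_def)
  have mset: "mset \<mu> = add_mset m (mset ?\<rho>)" using m(3) by simp
  have "(\<Sum>x\<leftarrow>\<mu>. x - 1) = (m - 1) + (\<Sum>x\<leftarrow>?\<rho>. x - 1)"
    using m(3) by (simp add: sum_list_map_remove1)
  then have "(\<Sum>x\<leftarrow>?\<rho>. x - 1) = 1" using m(1,2) by linarith
  moreover have "0 \<notin> set ?\<rho>" using pos notin_set_remove1 by metis
  ultimately have "mset ?\<rho> = add_mset 2 (replicate_mset (length ?\<rho> - 1) 1)"
    by (intro sum_pred_eq_1D)
  then obtain k where k: "mset \<mu> = add_mset m (add_mset 2 (replicate_mset k 1))" using mset by metis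
  have "n = m + 2 + k"
    using n arg_cong[OF k, of sum_mset] by (simp add: sum_mset_sum_list)
  then show range: "m \<in> {2..n - 2}" "4 \<le> n" using m(2) by auto
  have "mset \<mu> = mset (nh_partition n m)"
    using k \<open>n = m + 2 + k\<close> by (simp add: nh_partition_def)
  then show "\<mu> = nh_partition n m"
    using partition_eq_if_mset_eq[OF \<mu> nh_partition_in_partitions[OF range]] by blast
qed

text \<open>
  The functional has the prescribed values on the star basis. If \<open>\<mu>\<close> is \<open>a21\<dots>1\<close>, then \<open>a\<close> is at the same
  time the number of edges; by the previous lemma, a part equal to the number of edges characterises
  this shape.
\<close>

theorem forest_nh_star_forest:
  assumes \<mu>: "\<mu> \<in> partitions n" and n: "4 \<le> n"
  shows "stars.forest_nh \<mu> = of_bool (\<mu> \<in> nh_partition n ` {2..n - 2})"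
proof -
  let ?m = "card (edges (star_forest \<mu>))"
  have m: "?m = (\<Sum>x\<leftarrow>\<mu>. x - 1)" by (rule card_edges_star_forest)
  have form: "?m = a" if "\<mu> = nh_partition n a" "a \<in> {2..n - 2}" for a
    using that unfolding m by (simp add: nh_partition_def sum_list_replicate)
  consider "?m < 2" | "?m = 2" | "3 \<le> ?m" by linarith
  then show ?thesis
  proof cases
    case 1
    then have "\<mu> \<notin> nh_partition n ` {2..n - 2}" using form by force
    then show ?thesis using stars.forest_nh_few_edges[of \<mu>] 1 by simp
  next
    case 2
    then obtain e f where ef: "edges (star_forest \<mu>) = {e, f}" "e \<noteq> f" by (meson card_2_iff)
    then obtain i j i' j' where ij: "e = {(i, 0), (i, j)}" "i < length \<mu>" "1 \<le> j" "j < \<mu> ! i"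
      and ij': "f = {(i', 0), (i', j')}" "i' < length \<mu>" "1 \<le> j'" "j' < \<mu> ! i'"
      by (metis insertCI star_edgeE)
    have "e \<inter> f = {} \<longleftrightarrow> \<mu> \<in> nh_partition n ` {2..n - 2}"
    proof
      assume "e \<inter> f = {}"
      then have "i \<noteq> i'" using ij ij' by auto
      have "(\<Sum>k\<in>{i, i'}. \<mu> ! k - 1) \<le> (\<Sum>k<length \<mu>. \<mu> ! k - 1)"
        using ij(2) ij'(2) by (intro sum_mono2) auto
      then have "(\<mu> ! i - 1) + (\<mu> ! i' - 1) \<le> 2"
        using \<open>i \<noteq> i'\<close> 2 m sum_list_nth[of "\<lambda>x. x - 1" \<mu>] by simp
      then have "\<mu> ! i = 2" using ij ij' by linarith
      then have "2 \<in> set \<mu>" using ij(2) by (metis nth_mem)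
      then show "\<mu> \<in> nh_partition n ` {2..n - 2}"
        using partition_with_part_eq_edges[OF \<mu>, of 2] 2 m by auto
    next
      assume "\<mu> \<in> nh_partition n ` {2..n - 2}"
      then have \<mu>2: "\<mu> = nh_partition n 2" using form 2 by auto
      have small: "{(0, 0), (0, 1)} \<in> {e, f}" "{(1, 0), (1, 1)} \<in> {e, f}"
        unfolding ef(1)[symmetric] edges_star_forest \<mu>2 by (force simp: nh_partition_def)+
      then show "e \<inter> f = {}" by (auto simp: doubleton_eq_iff)
    qed
    then show ?thesis using stars.forest_nh_two_edges[OF ef] by simp
  next
    case 3
    show ?thesis
    proof (cases "\<mu> \<in> nh_partition n ` {2..n - 2}")
      case True
      then obtain a where a: "\<mu> = nh_partition n a" "?m = a" using form by auto
      then have "{i. i < length \<mu> \<and> \<mu> ! i = ?m} = {0}"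
        using nh_partition_largest[of a n] 3 by simp
      then show ?thesis using forest_nh_star_forest_ge3[OF 3] True by simp
    next
      case False
      have "{i. i < length \<mu> \<and> \<mu> ! i = ?m} = {}"
      proof (rule ccontr)
        assume "{i. i < length \<mu> \<and> \<mu> ! i = ?m} \<noteq> {}"
        then have "?m \<in> set \<mu>" by (auto simp: in_set_conv_nth)
        then show False using partition_with_part_eq_edges[OF \<mu> m] 3 False by auto
      qed
      then show ?thesis using forest_nh_star_forest_ge3[OF 3] False by simp
    qed
  qed
qed

theorem nh_eq_forest_nh:
  assumes "forest (verts G) (edges G)" "card (verts G) = n" "4 \<le> n"
    and "star_expansion n (chromatic_sf G) c"
  shows "nh n c = forest.forest_nh (verts G) (edges G)"
proof -
  have "forest.forest_nh (verts G) (edges G) = (\<Sum>\<mu>\<in>partitions n. c \<mu> * stars.forest_nh \<mu>)"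
    by (rule star_expansion_forest_nh[OF assms(1,2) _ _ assms(4)])
      (simp_all add: forest_star_forest card_verts_star_forest partitions_def)
  also have "\<dots> = (\<Sum>\<mu>\<in>partitions n. c \<mu> * of_bool (\<mu> \<in> nh_partition n ` {2..n - 2}))"
    by (intro sum.cong refl) (simp add: forest_nh_star_forest[OF _ assms(3)])
  also have "\<dots> = (\<Sum>\<mu>\<in>nh_partition n ` {2..n - 2}. c \<mu>)"
    using finite_partitions nh_partition_in_partitions[OF _ assms(3)]
    by (intro sum.mono_neutral_cong_right) auto
  also have "\<dots> = (\<Sum>a = 2..n - 2. c (nh_partition n a))"
    by (subst sum.reindex) (auto simp: inj_on_def nh_partition_def)
  also have "\<dots> = nh n c" unfolding nh_def nh_partition_def ..
  finally show ?thesis ..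
qed


section \<open>Trees\<close>

lemma linked_adjacent: "linked (edges G) = (adjacent G)\<^sup>*\<^sup>*"
  by (simp add: linked_def adjacent_def[abs_def])

lemma successively_path_edges:
  "path_edges xs \<subseteq> S \<Longrightarrow> successively (\<lambda>u v. {u, v} \<in> S) xs"
  by (auto simp: successively_conv_nth path_edges_def)

text \<open>
  A path that avoids an edge but joins its ends closes up to a cycle with this edge.
\<close>

lemma forest_tree:
  assumes "is_tree T"
  shows "forest (verts T) (edges T)"
proof
  have simple: "simple_graph T" and acyclic: "\<And>vs. \<not> is_cycle T vs"
    using assms by (auto simp: is_tree_def)
  show "e \<subseteq> verts T" "card e = 2" if "e \<in> edges T" for e
    using simple that by (auto simp: simple_graph_def)
  show "finite (verts T)" using simple by (simp add: simple_graph_def)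
  fix a b assume ab: "{a, b} \<in> edges T"
  show "\<not> linked (edges T - {{a, b}}) a b"
  proof
    let ?S = "edges T - {{a, b}}"
    assume "linked ?S a b"
    then obtain xs where xs: "distinct xs" "xs \<noteq> []" "hd xs = a" "last xs = b" "path_edges xs \<subseteq> ?S"
      using linked_imp_path by metis
    have "card {a, b} = 2" using simple ab by (auto simp: simple_graph_def)
    then have "a \<noteq> b" by auto
    have "length xs \<noteq> 1" using xs \<open>a \<noteq> b\<close> by (auto simp: length_Suc_conv)
    moreover have "length xs \<noteq> 2"
    proof
      assume "length xs = 2"
      then have "xs = [a, b]" using xs by (auto simp: numeral_2_eq_2 length_Suc_conv)
      then have "{a, b} \<in> path_edges xs" using path_edges_step[of 0 xs] by simp
      then show False using xs(5) by blast
    qed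
    moreover have "length xs \<noteq> 0" using xs(2) by simp
    ultimately have "3 \<le> length xs" by linarith
    moreover have "successively (adjacent T) xs"
      unfolding adjacent_def[abs_def] by (rule successively_path_edges) (use xs(5) in blast)
    moreover have "adjacent T (last xs) (hd xs)"
      using ab xs by (simp add: adjacent_def insert_commute)
    ultimately have "is_cycle T xs" using xs(1) by (simp add: is_cycle_def)
    then show False using acyclic by blast
  qed
qed

lemma card_edges_tree:
  assumes "is_tree T"
  shows "card (edges T) + 1 = card (verts T)"
proof -
  interpret forest "verts T" "edges T" using assms by (rule forest_tree)
  have ne: "verts T \<noteq> {}" and linked: "\<And>u v. u \<in> verts T \<Longrightarrow> v \<in> verts T \<Longrightarrow> linked (edges T) u v"
    using assms by (auto simp: is_tree_def connected_graph_def linked_adjacent)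
  have "block (verts T) (edges T) v = verts T" if "v \<in> verts T" for v
    using linked[OF that] by (auto simp: block_def)
  then have "blocks (verts T) (edges T) = {verts T}"
    using ne by (auto simp: blocks_def)
  then show ?thesis using card_blocks[OF order_refl] by simp
qed

text \<open>
  An isomorphism to a graph on \<open>{..<n}\<close> is a listing of the vertices. This replaces the choice of a
  bijection by statements about the positions in a list.
\<close>

lemma graph_iso_enumeration:
  assumes H: "verts H = {..<n}"
  shows "T \<cong>\<^sub>g H \<longleftrightarrow> (\<exists>xs. distinct xs \<and> length xs = n \<and> set xs = verts T \<and>
           (\<forall>i<n. \<forall>j<n. {xs ! i, xs ! j} \<in> edges T \<longleftrightarrow> {i, j} \<in> edges H))"
proof
  assume "T \<cong>\<^sub>g H"
  then obtain f where f: "bij_betw f (verts T) {..<n}"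
    and adj: "\<And>u v. u \<in> verts T \<Longrightarrow> v \<in> verts T \<Longrightarrow> {u, v} \<in> edges T \<longleftrightarrow> {f u, f v} \<in> edges H"
    unfolding graph_iso_def adjacent_def H by blast
  define g where "g = inv_into (verts T) f"
  have g: "bij_betw g {..<n} (verts T)"
    using f unfolding g_def by (rule bij_betw_inv_into)
  have fg: "f (g i) = i" if "i < n" for i
    using bij_betw_inv_into_right[OF f] that unfolding g_def by simp
  have gV: "g i \<in> verts T" if "i < n" for i
    using g that by (auto simp: bij_betw_def)
  let ?xs = "map g [0..<n]"
  have "distinct ?xs" "length ?xs = n" "set ?xs = verts T"
    using g by (auto simp: distinct_map bij_betw_def atLeast0LessThan)
  moreover have "{?xs ! i, ?xs ! j} \<in> edges T \<longleftrightarrow> {i, j} \<in> edges H" if "i < n" "j < n" for i j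
    using adj[OF gV gV, OF that] fg that by simp
  ultimately show "\<exists>xs. distinct xs \<and> length xs = n \<and> set xs = verts T \<and>
           (\<forall>i<n. \<forall>j<n. {xs ! i, xs ! j} \<in> edges T \<longleftrightarrow> {i, j} \<in> edges H)"
    by blast
next
  assume "\<exists>xs. distinct xs \<and> length xs = n \<and> set xs = verts T \<and>
           (\<forall>i<n. \<forall>j<n. {xs ! i, xs ! j} \<in> edges T \<longleftrightarrow> {i, j} \<in> edges H)"
  then obtain xs where xs: "distinct xs" "length xs = n" "set xs = verts T"
    and adj: "\<And>i j. i < n \<Longrightarrow> j < n \<Longrightarrow> {xs ! i, xs ! j} \<in> edges T \<longleftrightarrow> {i, j} \<in> edges H"
    by blast
  have nth: "bij_betw ((!) xs) {..<n} (verts T)"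
    using bij_betw_nth[OF xs(1)] xs(2,3) by simp
  define f where "f = inv_into {..<n} ((!) xs)"
  have f: "bij_betw f (verts T) {..<n}"
    using nth unfolding f_def by (rule bij_betw_inv_into)
  have xf: "xs ! f v = v" if "v \<in> verts T" for v
    using bij_betw_inv_into_right[OF nth that] unfolding f_def .
  have fn: "f v < n" if "v \<in> verts T" for v
    using f that by (auto simp: bij_betw_def)
  have "adjacent T u v \<longleftrightarrow> adjacent H (f u) (f v)" if "u \<in> verts T" "v \<in> verts T" for u v
    using adj[OF fn fn, OF that] xf that by (simp add: adjacent_def)
  then show "T \<cong>\<^sub>g H" using f unfolding graph_iso_def H by blast
qed

lemma path_graph_edge_iff: "{i, j} \<in> edges (path_graph n) \<longleftrightarrow> i < n \<and> j < n \<and> (j = Suc i \<or> i = Suc j)"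
  by (auto simp: path_graph_def doubleton_eq_iff)

lemma path_edges_nth_iff:
  assumes "distinct xs" "i < length xs" "j < length xs"
  shows "{xs ! i, xs ! j} \<in> path_edges xs \<longleftrightarrow> j = Suc i \<or> i = Suc j"
proof
  assume "{xs ! i, xs ! j} \<in> path_edges xs"
  then obtain k where "Suc k < length xs" "{xs ! i, xs ! j} = {xs ! k, xs ! Suc k}"
    by (auto simp: path_edges_def)
  then show "j = Suc i \<or> i = Suc j"
    using assms by (auto simp: doubleton_eq_iff nth_eq_iff_index_eq)
next
  assume "j = Suc i \<or> i = Suc j"
  then show "{xs ! i, xs ! j} \<in> path_edges xs"
    using assms path_edges_step[of i xs] path_edges_step[of j xs] by (auto simp: insert_commute)
qed

lemma (in forest) edge_nth:
  assumes "e \<in> E" "set xs = V"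
  obtains i j where "i < length xs" "j < length xs" "e = {xs ! i, xs ! j}"
proof -
  obtain a b where "e = {a, b}" "a \<in> set xs" "b \<in> set xs"
    using edge_obtain[OF assms(1)] assms(2) by metis
  then show thesis using that by (auto simp: in_set_conv_nth)
qed

lemma iso_path_graph_iff:
  assumes "forest (verts T) (edges T)" "card (verts T) = n"
  shows "T \<cong>\<^sub>g path_graph n \<longleftrightarrow> (\<exists>xs. distinct xs \<and> set xs = verts T \<and> edges T = path_edges xs)"
proof -
  interpret forest "verts T" "edges T" by fact
  have iso: "T \<cong>\<^sub>g path_graph n \<longleftrightarrow> (\<exists>xs. distinct xs \<and> length xs = n \<and> set xs = verts T \<and>
           (\<forall>i<n. \<forall>j<n. {xs ! i, xs ! j} \<in> edges T \<longleftrightarrow> {i, j} \<in> edges (path_graph n)))"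
    by (rule graph_iso_enumeration) (simp add: path_graph_def)
  have adjacency: "(\<forall>i<n. \<forall>j<n. {xs ! i, xs ! j} \<in> edges T \<longleftrightarrow> {i, j} \<in> edges (path_graph n)) \<longleftrightarrow> edges T = path_edges xs"
    if xs: "distinct xs" "length xs = n" "set xs = verts T" for xs
  proof
    assume adj: "\<forall>i<n. \<forall>j<n. {xs ! i, xs ! j} \<in> edges T \<longleftrightarrow> {i, j} \<in> edges (path_graph n)"
    show "edges T = path_edges xs"
    proof (intro equalityI subsetI)
      fix e assume e: "e \<in> edges T"
      then obtain i j where ij: "i < length xs" "j < length xs" "e = {xs ! i, xs ! j}"
        using xs(3) by (rule edge_nth)
      then have "j = Suc i \<or> i = Suc j" using adj e xs(2) path_graph_edge_iff by metis
      then show "e \<in> path_edges xs" using path_edges_nth_iff[OF xs(1) ij(1,2)] ij(3) by simp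
    next
      fix e assume "e \<in> path_edges xs"
      then obtain k where k: "Suc k < n" "e = {xs ! k, xs ! Suc k}"
        using xs(2) by (auto simp: path_edges_def)
      then show "e \<in> edges T" using adj path_graph_edge_iff[of k "Suc k" n] by simp
    qed
  next
    assume "edges T = path_edges xs"
    then show "\<forall>i<n. \<forall>j<n. {xs ! i, xs ! j} \<in> edges T \<longleftrightarrow> {i, j} \<in> edges (path_graph n)"
      using path_edges_nth_iff[OF xs(1)] xs(2) by (simp add: path_graph_edge_iff)
  qed
  have length: "length xs = n" if "distinct xs" "set xs = verts T" for xs
    using distinct_card[OF that(1)] assms(2) unfolding that(2) by simp
  show ?thesis
    unfolding iso by (rule iff_exI) (use adjacency length in metis)
qed

lemma cat_graph_edge_iff:
  assumes "4 \<le> n" "i < n" "j < n"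
  shows "{i, j} \<in> edges (cat_graph n) \<longleftrightarrow>
    (i = 0 \<and> j \<noteq> 0 \<and> j \<noteq> n - 1) \<or> (j = 0 \<and> i \<noteq> 0 \<and> i \<noteq> n - 1) \<or> {i, j} = {1, n - 1}"
proof -
  have "{i, j} \<in> edges (cat_graph n) \<longleftrightarrow>
      {i, j} = {0, 1} \<or> (\<exists>k. {i, j} = {0, k} \<and> 2 \<le> k \<and> k \<le> n - 2) \<or> {i, j} = {1, n - 1}"
    by (simp add: cat_graph_def disj_commute disj_left_commute)
  also have "(\<exists>k. {i, j} = {0, k} \<and> 2 \<le> k \<and> k \<le> n - 2) \<longleftrightarrow>
      (i = 0 \<and> 2 \<le> j \<and> j \<le> n - 2) \<or> (j = 0 \<and> 2 \<le> i \<and> i \<le> n - 2)"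
    unfolding doubleton_eq_iff by auto
  finally show ?thesis using assms unfolding doubleton_eq_iff by presburger
qed

context forest
begin

text \<open>
  An edge other than \<open>{u, v}\<close> misses \<open>u\<close> or \<open>v\<close>, so two such vertices would leave at most three edges.
\<close>

lemma hub_unique:
  assumes "4 \<le> card E" "u \<in> hubs" "v \<in> hubs"
  shows "u = v"
proof (rule ccontr)
  assume "u \<noteq> v"
  have "E \<subseteq> {e \<in> E. u \<notin> e} \<union> {e \<in> E. v \<notin> e} \<union> {{u, v}}"
  proof
    fix e assume "e \<in> E"
    moreover from this obtain a b where "e = {a, b}" by (rule edge_obtain)
    ultimately show "e \<in> {e \<in> E. u \<notin> e} \<union> {e \<in> E. v \<notin> e} \<union> {{u, v}}"
      using \<open>u \<noteq> v\<close> by auto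
  qed
  then have "card E \<le> card ({e \<in> E. u \<notin> e} \<union> {e \<in> E. v \<notin> e} \<union> {{u, v}})"
    using finite_E by (intro card_mono) auto
  also have "\<dots> \<le> card {e \<in> E. u \<notin> e} + card {e \<in> E. v \<notin> e} + card {{u, v}}"
    using card_Un_le[of "{e \<in> E. u \<notin> e} \<union> {e \<in> E. v \<notin> e}" "{{u, v}}"]
      card_Un_le[of "{e \<in> E. u \<notin> e}" "{e \<in> E. v \<notin> e}"] by linarith
  also have "\<dots> = 3" using assms(2,3) by (simp add: hubs_def)
  finally show False using assms(1) by simp
qed

text \<open>
  On a path every vertex lies on at most two edges and is therefore missed by at least two.
\<close>

lemma hubs_path:
  assumes "4 \<le> card E" "distinct xs" "E = path_edges xs"
  shows "hubs = {}"
proof -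
  have "card {e \<in> E. v \<notin> e} \<noteq> 1" for v
  proof -
    have "card E = card {e \<in> E. v \<in> e} + card {e \<in> E. v \<notin> e}"
      using finite_E by (subst card_Un_disjoint[symmetric]) (auto intro: arg_cong[where f = card])
    moreover have "card {e \<in> E. v \<in> e} \<le> 2"
      using card_path_edges_at[OF assms(2)] assms(3) by simp
    ultimately show ?thesis using assms(1) by linarith
  qed
  then show ?thesis by (simp add: hubs_def)
qed

text \<open>
  If the single edge \<open>f\<close> misses \<open>v\<close>, then by counting edges \<open>v\<close> is adjacent to all other vertices but
  one, which is called \<open>w\<close>. The ends of \<open>f\<close> are not both adjacent to \<open>v\<close>, as this would close a
  triangle. Hence \<open>f\<close> joins \<open>w\<close> to a neighbour \<open>a\<close> of \<open>v\<close>.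
\<close>

lemma hub_structure:
  assumes tree: "card E + 1 = card V" and hub: "v \<in> hubs"
  obtains a w where "a \<in> V" "w \<in> V" "distinct [v, a, w]" "E = insert {a, w} ((\<lambda>x. {v, x}) ` (V - {v, w}))"
proof -
  define N where "N = {x \<in> V. {v, x} \<in> E}"
  have v: "v \<in> V" and avoid: "card {e \<in> E. v \<notin> e} = 1" using hub by (auto simp: hubs_def)
  have "{v, v} \<notin> E" using edge_card[of "{v, v}"] by auto
  then have N: "N \<subseteq> V - {v}" by (auto simp: N_def)
  obtain f where f: "{e \<in> E. v \<notin> e} = {f}" using avoid by (rule card_1_singletonE)
  then have fE: "f \<in> E" "v \<notin> f" by auto
  obtain a b where ab: "f = {a, b}" "a \<noteq> b" "a \<in> V" "b \<in> V"
    using fE(1) by (rule edge_obtain)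
  have at_v: "{e \<in> E. v \<in> e} = (\<lambda>x. {v, x}) ` N"
  proof (intro equalityI subsetI)
    fix e assume e: "e \<in> {e \<in> E. v \<in> e}"
    then have "e \<in> E" by simp
    then obtain p q where "e = {p, q}" "p \<in> V" "q \<in> V" by (rule edge_obtain)
    then show "e \<in> (\<lambda>x. {v, x}) ` N" using e by (auto simp: N_def insert_commute)
  qed (auto simp: N_def)
  have E: "E = insert f ((\<lambda>x. {v, x}) ` N)"
    unfolding at_v[symmetric] using f fE by auto
  have "inj_on (\<lambda>x. {v, x}) N" by (auto simp: inj_on_def doubleton_eq_iff)
  moreover have "f \<notin> (\<lambda>x. {v, x}) ` N" using fE(2) by auto
  moreover have "finite N" using finite_V by (simp add: N_def)
  ultimately have "card E = Suc (card N)" using E by (simp add: card_image)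
  then have "card (V - {v} - N) = 1"
    using tree v finite_V N by (subst card_Diff_subset) (auto intro: finite_subset)
  then obtain w where w: "V - {v} - N = {w}" by (rule card_1_singletonE)
  then have NV: "N = V - {v, w}" and wV: "w \<in> V" "w \<noteq> v" using N by auto
  have "\<not> (a \<in> N \<and> b \<in> N)"
  proof
    assume "a \<in> N \<and> b \<in> N"
    then have "{v, a} \<in> E - {f}" "{v, b} \<in> E - {f}" using fE(2) by (auto simp: N_def)
    then have "linked (E - {f}) a b" using linked_edge linked_sym linked_trans by metis
    then show False using bridge[of a b] fE(1) ab(1) by simp
  qed
  moreover have "a \<noteq> v" "b \<noteq> v" using fE(2) ab(1) by auto
  ultimately have "a = w \<or> b = w" using ab NV by auto
  then show thesis
  proof
    assume "a = w"
    then show thesis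
      using that[of b w] ab wV \<open>b \<noteq> v\<close> E NV by (auto simp: insert_commute)
  next
    assume "b = w"
    then show thesis
      using that[of a w] ab wV \<open>a \<noteq> v\<close> E NV by auto
  qed
qed

end

lemma iso_cat_graph_iff:
  assumes tree: "is_tree T" and n: "card (verts T) = n" "4 \<le> n"
  shows "T \<cong>\<^sub>g cat_graph n \<longleftrightarrow> forest.hubs (verts T) (edges T) \<noteq> {}"
proof -
  interpret forest "verts T" "edges T" using tree by (rule forest_tree)
  let ?V = "verts T" and ?E = "edges T"
  have iso: "T \<cong>\<^sub>g cat_graph n \<longleftrightarrow> (\<exists>xs. distinct xs \<and> length xs = n \<and> set xs = ?V \<and>
           (\<forall>i<n. \<forall>j<n. {xs ! i, xs ! j} \<in> ?E \<longleftrightarrow> {i, j} \<in> edges (cat_graph n)))"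
    by (rule graph_iso_enumeration) (simp add: cat_graph_def)
  show ?thesis
  proof
    assume "T \<cong>\<^sub>g cat_graph n"
    then obtain xs where xs: "distinct xs" "length xs = n" "set xs = ?V"
      and adj: "\<And>i j. i < n \<Longrightarrow> j < n \<Longrightarrow> {xs ! i, xs ! j} \<in> ?E \<longleftrightarrow> {i, j} \<in> edges (cat_graph n)"
      unfolding iso by blast
    have "{e \<in> ?E. xs ! 0 \<notin> e} = {{xs ! 1, xs ! (n - 1)}}"
    proof (intro equalityI subsetI)
      fix e assume e: "e \<in> {e \<in> ?E. xs ! 0 \<notin> e}"
      then have "e \<in> ?E" by simp
      then obtain i j where ij: "i < n" "j < n" "e = {xs ! i, xs ! j}"
        using edge_nth xs(2,3) by metis
      then have "{i, j} \<in> edges (cat_graph n)" "i \<noteq> 0" "j \<noteq> 0" using adj e by auto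
      then have "{i, j} = {1, n - 1}" using cat_graph_edge_iff[OF n(2) ij(1,2)] by auto
      then show "e \<in> {{xs ! 1, xs ! (n - 1)}}"
        using ij(3) by (auto simp: doubleton_eq_iff)
    next
      fix e assume "e \<in> {{xs ! 1, xs ! (n - 1)}}"
      then have e: "e = {xs ! 1, xs ! (n - 1)}" by simp
      have "{1, n - 1} \<in> edges (cat_graph n)" by (simp add: cat_graph_def)
      then have "e \<in> ?E" using adj[of 1 "n - 1"] n(2) e by simp
      moreover have "xs ! 0 \<noteq> xs ! 1" "xs ! 0 \<noteq> xs ! (n - 1)"
        using nth_eq_iff_index_eq[OF xs(1), of 0] n(2) xs(2) by auto
      ultimately show "e \<in> {e \<in> ?E. xs ! 0 \<notin> e}" using e by simp
    qed
    moreover have "xs ! 0 \<in> ?V" using xs(2,3) n(2) nth_mem[of 0 xs] by simp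
    ultimately have "xs ! 0 \<in> hubs" by (simp add: hubs_def)
    then show "hubs \<noteq> {}" by blast
  next
    assume "hubs \<noteq> {}"
    then obtain v where v: "v \<in> hubs" by blast
    then obtain a w where aw: "a \<in> ?V" "w \<in> ?V" "distinct [v, a, w]"
      and E: "?E = insert {a, w} ((\<lambda>x. {v, x}) ` (?V - {v, w}))"
      using hub_structure[OF card_edges_tree[OF tree]] by metis
    have vV: "v \<in> ?V" using v by (simp add: hubs_def)
    obtain os where os: "set os = ?V - {v, a, w}" "distinct os"
      using finite_distinct_list[of "?V - {v, a, w}"] finite_V by auto
    \<comment> \<open>The order of the vertices of \<open>cat_graph n\<close>: \<open>v\<close> plays \<open>v\<^sub>1\<close>, \<open>a\<close> plays \<open>v\<^sub>2\<close>, and \<open>w\<close> is the leaf at \<open>v\<^sub>2\<close>.\<close>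
    define xs where "xs = [v, a] @ os @ [w]"
    have xs: "distinct xs" "set xs = ?V" using os aw vV by (auto simp: xs_def)
    then have len: "length xs = n" using distinct_card[of xs] n(1) by simp
    have zero: "xs ! i = v \<longleftrightarrow> i = 0" and one: "xs ! i = a \<longleftrightarrow> i = 1" and last: "xs ! i = w \<longleftrightarrow> i = n - 1"
      if i: "i < n" for i
    proof -
      have "n - 1 = Suc (Suc (length os))" using len by (simp add: xs_def)
      then have ends: "xs ! 0 = v" "xs ! 1 = a" "xs ! (n - 1) = w" by (simp_all add: xs_def)
      have index: "xs ! i = xs ! k \<longleftrightarrow> i = k" if "k < n" for k
        using nth_eq_iff_index_eq[OF xs(1)] i that len by simp
      have bounds: "0 < n" "1 < n" "n - 1 < n" using n(2) by simp_all
      show "xs ! i = v \<longleftrightarrow> i = 0" using index[OF bounds(1)] ends(1) by metis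
      show "xs ! i = a \<longleftrightarrow> i = 1" using index[OF bounds(2)] ends(2) by metis
      show "xs ! i = w \<longleftrightarrow> i = n - 1" using index[OF bounds(3)] ends(3) by metis
    qed
    have "{xs ! i, xs ! j} \<in> ?E \<longleftrightarrow> {i, j} \<in> edges (cat_graph n)" if ij: "i < n" "j < n" for i j
    proof -
      have V: "xs ! k \<in> ?V" if "k < n" for k
        using nth_mem[of k xs] that len xs(2) by simp
      have "{x, y} \<in> ?E \<longleftrightarrow> (x = v \<and> y \<noteq> v \<and> y \<noteq> w) \<or> (y = v \<and> x \<noteq> v \<and> x \<noteq> w) \<or> {x, y} = {a, w}"
        if "x \<in> ?V" "y \<in> ?V" for x y
      proof -
        have "{x, y} \<in> ?E \<longleftrightarrow> {x, y} = {a, w} \<or> (\<exists>z\<in>?V - {v, w}. {x, y} = {v, z})"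
          unfolding E by blast
        also have "(\<exists>z\<in>?V - {v, w}. {x, y} = {v, z}) \<longleftrightarrow>
            (x = v \<and> y \<noteq> v \<and> y \<noteq> w) \<or> (y = v \<and> x \<noteq> v \<and> x \<noteq> w)"
          using that unfolding doubleton_eq_iff by auto
        finally show ?thesis by blast
      qed
      from this[OF V V, OF ij] show ?thesis
        unfolding cat_graph_edge_iff[OF n(2) ij] doubleton_eq_iff
          zero[OF ij(1)] zero[OF ij(2)] one[OF ij(1)] one[OF ij(2)] last[OF ij(1)] last[OF ij(2)] .
    qed
    then show "T \<cong>\<^sub>g cat_graph n" unfolding iso using xs len by blast
  qed
qed

lemma iso_path_graph_iff_separated:
  assumes tree: "is_tree T" and n: "card (verts T) = n" "2 \<le> n"
  shows "T \<cong>\<^sub>g path_graph n \<longleftrightarrow> forest.separated_pairs (verts T) (edges T) \<noteq> {}"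
proof -
  interpret forest "verts T" "edges T" using tree by (rule forest_tree)
  have iso: "T \<cong>\<^sub>g path_graph n \<longleftrightarrow> (\<exists>xs. distinct xs \<and> set xs = verts T \<and> edges T = path_edges xs)"
    by (rule iso_path_graph_iff) (use n forest_tree[OF tree] in auto)
  show ?thesis
  proof
    assume "T \<cong>\<^sub>g path_graph n"
    then obtain xs where xs: "distinct xs" "set xs = verts T" "edges T = path_edges xs"
      unfolding iso by blast
    then have "2 \<le> length xs" using distinct_card[of xs] n by simp
    then have "card separated_pairs = 2" using xs by (intro card_separated_pairs_path)
    then show "separated_pairs \<noteq> {}" by auto
  next
    assume "separated_pairs \<noteq> {}"
    then obtain u v where "(u, v) \<in> separated_pairs" by auto
    then obtain xs where xs: "distinct xs" "edges T = path_edges xs" by (rule separated_pair_imp_path)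
    have "card (edges T) = n - 1" using card_edges_tree[OF tree] n by simp
    then have len: "length xs = n" using card_path_edges[OF xs(1)] xs(2) n(2) by simp
    then have "set xs = \<Union> (edges T)" using Union_path_edges[of xs] n(2) xs(2) by simp
    then have "set xs \<subseteq> verts T" using edge_subset by blast
    moreover have "card (set xs) = card (verts T)" using distinct_card[OF xs(1)] len n(1) by simp
    ultimately have "set xs = verts T" using finite_V by (metis card_subset_eq)
    then show "T \<cong>\<^sub>g path_graph n" unfolding iso using xs by blast
  qed
qed

theorem lemma4p8:
  fixes T :: "'a graph" and n :: nat and c :: "nat list \<Rightarrow> rat"
  assumes "is_tree T"
    and "card (verts T) = n"
    and "n \<ge> 5"
    and "star_expansion n (chromatic_sf T) c"
  shows "(\<not> T \<cong>\<^sub>g cat_graph n \<and> \<not> T \<cong>\<^sub>g path_graph n \<longrightarrow> nh n c = 0) \<and>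
         (T \<cong>\<^sub>g cat_graph n \<longrightarrow> nh n c = 1) \<and>
         (T \<cong>\<^sub>g path_graph n \<longrightarrow> nh n c = (-1) ^ (n - 1))"
proof -
  interpret forest "verts T" "edges T" using assms(1) by (rule forest_tree)
  have E: "card (edges T) = n - 1" using card_edges_tree[OF assms(1)] assms(2) by simp
  have E4: "4 \<le> card (edges T)" using E assms(3) by simp
  have "nh n c = forest_nh"
    using nh_eq_forest_nh[OF forest_tree[OF assms(1)] assms(2) _ assms(4)] assms(3) by simp
  also have "\<dots> = of_nat (card hubs) + (-1) ^ (n - 1) * of_nat (card separated_pairs) / 2"
    unfolding forest_nh_eq using E4 by (simp add: E)
  finally have nh: "nh n c = of_nat (card hubs) + (-1) ^ (n - 1) * of_nat (card separated_pairs) / 2" .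
  have cat: "T \<cong>\<^sub>g cat_graph n \<longleftrightarrow> hubs \<noteq> {}"
    using assms by (intro iso_cat_graph_iff) auto
  have path: "T \<cong>\<^sub>g path_graph n \<longleftrightarrow> separated_pairs \<noteq> {}"
    using assms by (intro iso_path_graph_iff_separated) auto
  have one_hub: "card hubs = 1" if "hubs \<noteq> {}"
  proof -
    from that obtain v where v: "v \<in> hubs" by blast
    then have "hubs = {v}" using hub_unique[OF E4 _ v] by blast
    then show ?thesis by simp
  qed
  have on_path: "card separated_pairs = 2 \<and> hubs = {}" if "separated_pairs \<noteq> {}"
  proof -
    from that obtain u v where "(u, v) \<in> separated_pairs" by auto
    then obtain xs where xs: "distinct xs" "edges T = path_edges xs" by (rule separated_pair_imp_path)
    have "2 \<le> length xs" using card_path_edges[OF xs(1)] xs(2) E4 by simp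
    then show ?thesis
      using card_separated_pairs_path[OF xs(1) _ xs(2)] hubs_path[OF E4 xs] by simp
  qed
  show ?thesis
    unfolding cat path nh using one_hub on_path by (cases "separated_pairs = {}"; cases "hubs = {}") auto
qed

end
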